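(* Consider the hexagonal network under Model 2 with only Rx-cooperation and an unlimited number of cooperation rounds ($D=\infty$), as defined in the context. For $\rho\in(0,1)$ and $\rho_f\in(0,1]$, the fundamental MG region $\mathcal S_2^\star(D=\infty,\rho,\rho_f)$ includes all nonnegative pairs $(S^{(U)},S^{(e)})$ satisfying $$S^{(U)}\le\frac{\rho\rho_f}{3},\qquad S^{(e)}+L\cdot S^{(U)}\le\rho(1-\rho_f),\qquad\text{where } L=\frac{2(1-\rho_f)\left(1-(1-\rho\rho_f)^3\right)}{\rho_f}.$$
   Context: Hexagonal network: for each $K$ there are $K$ hexagonal cells indexed by $\mathcal K=\{1,\dots,K\}$, each with one transmitter (Tx) and one receiver (Rx). Cell $k$ has position $o_k=a_k\mathbf e_x+b_k\mathbf e_y$ in the complex plane with distinct integer pairs $(a_k,b_k)$, where $\mathbf e_x=\frac{\sqrt3}{2}-\frac12 i$ and $\mathbf e_y=i$. The neighbour set and interference set of $k$ coincide: $\mathcal N_k=\mathcal I_k$ is the set of the (at most six) adjacent cells $k'\in\mathcal K$, i.e. those with $(a_k-a_{k'},b_k-b_{k'})\in\{\pm(1,0),\pm(0,1),\pm(1,1)\}$ (equivalently $|o_k-o_{k'}|=1$). Activity. Each Tx $k$ is active ($A_k=1$) with probability $\rho$, independently over $k$, and $A_k=0$ otherwise. Given that Tx $k$ is active, $B_k=1$ with probability $\rho_f$, independently of everything else, and $B_k=0$ otherwise. Let $\mathcal K_{active}=\{k:A_k=1\}$, $\mathcal K_{URLLC}=\{k:A_k=1,B_k=1\}$. Model 2: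 each Tx in $\mathcal K_{URLLC}$ has only a URLLC message, and each Tx in $\mathcal K_{eMBB}=\mathcal K_{active}\setminus\mathcal K_{URLLC}$ has only an eMBB message. Write $\mathbf A,\mathbf B$ for the activity tuples; all terminals know $(\mathbf A,\mathbf B)$. Messages. For blocklength $n$, the eMBB message $M_k^{(e)}$ ($k\in\mathcal K_{eMBB}$) is uniform on $\{1,\dots,\lfloor 2^{nR_k^{(e)}}\rfloor\}$, where $R_k^{(e)}$ may depend on $k$ and on $(\mathbf A,\mathbf B)$. The URLLC message $M_k^{(U)}$ ($k\in\mathcal K_{URLLC}$) is uniform on $\{1,\dots,\lfloor 2^{nR^{(U)}}\rfloor\}$, with the same rate $R^{(U)}$ for all $k$, not depending on $(\mathbf A,\mathbf B)$. Messages are independent. Channel. For $t=1,\dots,n$, $Y_{k,t}=h_{k,k}X_{k,t}+\sum_{\tilde k\in\mathcal I_k}h_{\tilde k,k}X_{\tilde k,t}+Z_{k,t}$, where inactive Txs send zero, the $h_{\tilde k,k}\ge 0$ are fixed real numbers, and the $Z_{k,t}$ are i.i.d. standard Gaussian, independent of all messages. Communication with only Rx-cooperation. (i) Each active Tx $k$ computes $X_k^n$ as a function of its own message and $(\mathbf A,\mathbf B)$, subject to $\frac1n\sum_{t=1}^n X_{k,t}^2\le P$ almost surely. (ii) Each Rx $k\in\mathcal K_{URLLC}$ decodes $M_k^{(U)}$ from $Y_k^n$ and $(\mathbf A,\mathbf B)$ only. (iii) Rx-cooperation rounds, whose number may be any finite number ($D=\infty$: no constraint on the number of rounds): in each round every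 active Rx $k$ sends to each active neighbour in $\mathcal N_k$ over a noise-free link of unlimited capacity an arbitrary function of $Y_k^n$, the cooperation messages it received in previous rounds, and $(\mathbf A,\mathbf B)$. (iv) Each Rx $k\in\mathcal K_{eMBB}$ decodes $M_k^{(e)}$ from $Y_k^n$, all cooperation messages it received, and $(\mathbf A,\mathbf B)$. Achievability. For given $P,K$, a pair $(R^{(U)}(P),\bar R_K^{(e)}(P))$ is achievable if there exist rates $R_k^{(e)}$ with $\bar R_K^{(e)}\le \mathbb E_{\mathbf A,\mathbf B}\big[\frac1K\sum_{k\in\mathcal K_{eMBB}}R_k^{(e)}\big]$ and encoding functions (of the own message and $(\mathbf A,\mathbf B)$, obeying the power constraint $\frac1n\sum_{t=1}^n X_{k,t}^2\le P$ almost surely), URLLC decoding functions (of $Y_k^n$ and $(\mathbf A,\mathbf B)$), Rx-cooperation functions for some finite number of rounds (of $Y_k^n$, the previously received Rx-cooperation messages and $(\mathbf A,\mathbf B)$) and eMBB decoding functions (of $Y_k^n$, all received Rx-cooperation messages and $(\mathbf A,\mathbf B)$) such that the probability that some URLLC message ($k\in\mathcal K_{URLLC}$) or some eMBB message ($k\in\mathcal K_{eMBB}$) is decoded incorrectly tends to $0$ as $n\to\infty$. A multiplexing gain (MG) pair $(S^{(U)},S^{(e)})$ is achievable if for all $P>0$ (and all $K$) there exist achievable rates with $S^{(U)}=\rho\rho_f\,\varlimsup_{K\to\infty}\varlimsup_{P\to\infty}\frac{R^{(U)}(P)}{\frac12\log P}$ and $S^{(e)}=\varlimsup_{K\to\infty}\varlimsup_{P\to\infty}\frac{\bar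 R_K^{(e)}(P)}{\frac12\log P}$. The fundamental MG region $\mathcal S_2^\star(D=\infty,\rho,\rho_f)$ is here the closure of the set of all achievable MG pairs under Model 2 with only Rx-cooperation.
   Formalization: The channel gains are additionally assumed generic: for every set of active cells, the channel matrix between their Txs and Rxs is nonsingular (true outside a null set). For arbitrary gains h ≥ 0 the claim fails, e.g. when all gains are zero. *)

theory Defs
  imports "HOL-Probability.Probability"
begin

section \<open>Hexagonal networks\<close>

record network =
  coord :: "nat \<Rightarrow> int \<times> int"
  gain :: "nat \<Rightarrow> nat \<Rightarrow> real"  \<comment> \<open>\<open>gain N j k\<close>: coefficient from Tx \<open>j\<close> to Rx \<open>k\<close>\<close>

definition e_x :: complex where "e_x = Complex (sqrt 3 / 2) (- 1 / 2)"
definition e_y :: complex where "e_y = \<i>"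

definition cell_pos :: "network \<Rightarrow> nat \<Rightarrow> complex" where
  "cell_pos N k = of_int (fst (coord N k)) * e_x + of_int (snd (coord N k)) * e_y"

text \<open>A network with cells \<open>1, \<dots>, K\<close>; values of the record fields at other indices are never used.\<close>

definition hexagonal_network :: "nat \<Rightarrow> network \<Rightarrow> bool" where
  "hexagonal_network K N \<longleftrightarrow>
     inj_on (coord N) {1..K} \<and> (\<forall>j\<in>{1..K}. \<forall>k\<in>{1..K}. 0 \<le> gain N j k)"

definition neighbours :: "nat \<Rightarrow> network \<Rightarrow> nat \<Rightarrow> nat set" where
  "neighbours K N k =
     {k' \<in> {1..K}. coord N k - coord N k' \<in> {(1,0), (-1,0), (0,1), (0,-1), (1,1), (-1,-1)}}"

lemma norm_cell_pos_diff:
  "(cmod (cell_pos N k - cell_pos N l))\<^sup>2 =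
     (let (p, q) = coord N k - coord N l in of_int (p\<^sup>2 - p * q + q\<^sup>2))"
proof -
  obtain a b where k: "coord N k = (a, b)" by (cases "coord N k")
  obtain c d where l: "coord N l = (c, d)" by (cases "coord N l")
  have s: "sqrt 3 * sqrt 3 = 3" by simp
  have "(cmod (cell_pos N k - cell_pos N l))\<^sup>2 =
      (sqrt 3 * sqrt 3) / 4 * (real_of_int a - c)\<^sup>2 + ((b - d) - (a - c) / 2)\<^sup>2"
    unfolding cmod_power2
    by (simp add: cell_pos_def k l e_x_def e_y_def power2_eq_square field_simps)
  also have "\<dots> = of_int ((a - c)\<^sup>2 - (a - c) * (b - d) + (b - d)\<^sup>2)"
    unfolding s by (simp add: power2_eq_square field_simps)
  finally show ?thesis by (simp add: k l)
qed

lemma neighbours_eq_unit_distance: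
  "neighbours K N k = {k' \<in> {1..K}. cmod (cell_pos N k - cell_pos N k') = 1}"
proof -
  have *: "(p, q) \<in> {(1,0), (-1,0), (0,1), (0,-1), (1,1), (-1,-1)}
      \<longleftrightarrow> p\<^sup>2 - p * q + q\<^sup>2 = 1" for p q :: int
  proof
    assume h: "p\<^sup>2 - p * q + q\<^sup>2 = 1"
    have "(2*q - p)\<^sup>2 + 3 * p\<^sup>2 = 4" "(2*p - q)\<^sup>2 + 3 * q\<^sup>2 = 4"
      using h by (auto simp: power2_eq_square algebra_simps)
    then have "3 * p\<^sup>2 \<le> 4" "3 * q\<^sup>2 \<le> 4"
      using zero_le_power2[of "2*q - p"] zero_le_power2[of "2*p - q"] by linarith+
    then have "p\<^sup>2 < 2\<^sup>2" "q\<^sup>2 < 2\<^sup>2" by simp_all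
    then have "\<bar>p\<bar> < 2" "\<bar>q\<bar> < 2"
      by (metis abs_numeral power2_abs power_less_imp_less_base zero_le_numeral)+
    then have "p \<in> {-1, 0, 1}" "q \<in> {-1, 0, 1}" by auto
    then show "(p, q) \<in> {(1,0), (-1,0), (0,1), (0,-1), (1,1), (-1,-1)}"
      using h by auto
  qed auto
  have "cmod (cell_pos N k - cell_pos N l) = 1 \<longleftrightarrow>
      coord N k - coord N l \<in> {(1,0), (-1,0), (0,1), (0,-1), (1,1), (-1,-1)}" for l
  proof -
    obtain p q where pq: "coord N k - coord N l = (p, q)" by (cases "coord N k - coord N l")
    have "cmod (cell_pos N k - cell_pos N l) = 1 \<longleftrightarrow> (cmod (cell_pos N k - cell_pos N l))\<^sup>2 = 1"
      by (simp add: power2_eq_1_iff) (metis norm_ge_zero le_minus_one_simps(3))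
    also have "\<dots> \<longleftrightarrow> p\<^sup>2 - p * q + q\<^sup>2 = 1"
      unfolding norm_cell_pos_diff pq by (simp only: Let_def case_prod_conv of_int_eq_1_iff)
    finally show ?thesis unfolding * pq .
  qed
  then show ?thesis by (simp add: neighbours_def)
qed

text \<open>
  Genericity of the gains: for every set \<open>T\<close> of cells (thought of as the active ones) the square
  matrix of gains between the Txs and Rxs in \<open>T\<close>, with zeros between non-adjacent cells, is
  nonsingular, i.e. has trivial kernel. In particular \<open>gain N k k \<noteq> 0\<close>. The condition excludes
  only a Lebesgue null set of gains. Without such a condition full multiplexing gain is not
  attainable, as the cases \<open>gain N j k = 0\<close> or \<open>gain N j k = 1\<close> for all \<open>j\<close>, \<open>k\<close> show.
\<close>

definition generic_gains :: "nat \<Rightarrow> network \<Rightarrow> bool" where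
  "generic_gains K N \<longleftrightarrow>
     (\<forall>T \<subseteq> {1..K}. \<forall>x :: nat \<Rightarrow> real.
        (\<forall>k\<in>T. gain N k k * x k + (\<Sum>j \<in> neighbours K N k \<inter> T. gain N j k * x j) = 0)
        \<longrightarrow> (\<forall>k\<in>T. x k = 0))"


section \<open>Random activity\<close>

text \<open>\<open>s k = (A\<^sub>k, B\<^sub>k)\<close>; inactive cells, and indices outside \<open>{1..K}\<close>, have \<open>(False, False)\<close>.\<close>

type_synonym activity = "nat \<Rightarrow> bool \<times> bool"

definition cell_activity_pmf :: "real \<Rightarrow> real \<Rightarrow> (bool \<times> bool) pmf" where
  "cell_activity_pmf \<rho> \<rho>\<^sub>f =
     bind_pmf (bernoulli_pmf \<rho>)
       (\<lambda>a. if a then map_pmf (Pair True) (bernoulli_pmf \<rho>\<^sub>f) else return_pmf (False, False))"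

definition activity_pmf :: "real \<Rightarrow> real \<Rightarrow> nat \<Rightarrow> activity pmf" where
  "activity_pmf \<rho> \<rho>\<^sub>f K = Pi_pmf {1..K} (False, False) (\<lambda>_. cell_activity_pmf \<rho> \<rho>\<^sub>f)"

definition active :: "nat \<Rightarrow> activity \<Rightarrow> nat set" where
  "active K s = {k \<in> {1..K}. fst (s k)}"

definition urllc :: "nat \<Rightarrow> activity \<Rightarrow> nat set" where
  "urllc K s = {k \<in> {1..K}. fst (s k) \<and> snd (s k)}"

definition embb :: "nat \<Rightarrow> activity \<Rightarrow> nat set" where
  "embb K s = active K s - urllc K s"


section \<open>Coding schemes with Rx-cooperation only\<close>

text \<open>
  A cooperation message is a sequence of reals with the product Borel structure, so that it can
  carry any finite or countable collection of real or discrete data.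
\<close>

type_synonym coop_msg = "nat \<Rightarrow> real"

abbreviation coop_msg_space :: "coop_msg measure" where
  "coop_msg_space \<equiv> (\<Pi>\<^sub>M i\<in>UNIV. borel)"

text \<open>The messages an Rx has received so far, indexed by round and sender.\<close>

type_synonym inbox = "nat \<times> nat \<Rightarrow> coop_msg"

record scheme =
  rounds :: nat
  enc :: "activity \<Rightarrow> nat \<Rightarrow> nat \<Rightarrow> nat \<Rightarrow> real"
    \<comment> \<open>\<open>enc c s k m t\<close>: input of Tx \<open>k\<close> at time \<open>t\<close> for message \<open>m\<close>\<close>
  dec_urllc :: "activity \<Rightarrow> nat \<Rightarrow> (nat \<Rightarrow> real) \<Rightarrow> nat"
  coop :: "activity \<Rightarrow> nat \<Rightarrow> nat \<Rightarrow> nat \<Rightarrow> (nat \<Rightarrow> real) \<times> inbox \<Rightarrow> coop_msg"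
    \<comment> \<open>\<open>coop c s d j k (y, v)\<close>: message from Rx \<open>j\<close> to Rx \<open>k\<close> in round \<open>d\<close>, given the output
        \<open>y\<close> at Rx \<open>j\<close> and the messages \<open>v\<close> received by Rx \<open>j\<close> in rounds before \<open>d\<close>\<close>
  dec_embb :: "activity \<Rightarrow> nat \<Rightarrow> (nat \<Rightarrow> real) \<times> inbox \<Rightarrow> nat"

definition num_messages :: "nat \<Rightarrow> real \<Rightarrow> nat" where
  "num_messages n R = nat \<lfloor>2 powr (real n * R)\<rfloor>"

definition tx_rate :: "nat \<Rightarrow> real \<Rightarrow> (activity \<Rightarrow> nat \<Rightarrow> real) \<Rightarrow> activity \<Rightarrow> nat \<Rightarrow> real" where
  "tx_rate K R\<^sub>U R\<^sub>e s k = (if k \<in> urllc K s then R\<^sub>U else R\<^sub>e s k)"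

definition active_nbrs :: "nat \<Rightarrow> network \<Rightarrow> activity \<Rightarrow> nat \<Rightarrow> nat set" where
  "active_nbrs K N s k = neighbours K N k \<inter> active K s"

abbreviation output_space :: "nat \<Rightarrow> (nat \<Rightarrow> real) measure" where
  "output_space n \<equiv> (\<Pi>\<^sub>M t\<in>{1..n}. borel)"

text \<open>What Rx \<open>k\<close> holds after \<open>d\<close> cooperation rounds.\<close>

definition inbox_space :: "nat \<Rightarrow> network \<Rightarrow> activity \<Rightarrow> nat \<Rightarrow> nat \<Rightarrow> inbox measure" where
  "inbox_space K N s d k = (\<Pi>\<^sub>M i \<in> {1..d} \<times> active_nbrs K N s k. coop_msg_space)"

definition valid_scheme ::
  "nat \<Rightarrow> network \<Rightarrow> real \<Rightarrow> real \<Rightarrow> real \<Rightarrow> real \<Rightarrow> (activity \<Rightarrow> nat \<Rightarrow> real) \<Rightarrow> nat \<Rightarrow> scheme \<Rightarrow> bool"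
where
  "valid_scheme K N \<rho> \<rho>\<^sub>f P R\<^sub>U R\<^sub>e n c \<longleftrightarrow>
     (\<forall>s \<in> set_pmf (activity_pmf \<rho> \<rho>\<^sub>f K).
        (\<forall>k \<in> active K s. \<forall>m \<in> {1..num_messages n (tx_rate K R\<^sub>U R\<^sub>e s k)}.
           (1 / real n) * (\<Sum>t=1..n. (enc c s k m t)\<^sup>2) \<le> P) \<and>
        (\<forall>k \<in> urllc K s. dec_urllc c s k \<in> output_space n \<rightarrow>\<^sub>M count_space UNIV) \<and>
        (\<forall>d \<in> {1..rounds c}. \<forall>j \<in> active K s. \<forall>k \<in> active_nbrs K N s j.
           coop c s d j k \<in> output_space n \<Otimes>\<^sub>M inbox_space K N s (d - 1) j \<rightarrow>\<^sub>M coop_msg_space) \<and>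
        (\<forall>k \<in> embb K s.
           dec_embb c s k \<in> output_space n \<Otimes>\<^sub>M inbox_space K N s (rounds c) k
             \<rightarrow>\<^sub>M count_space UNIV))"

definition channel_input :: "nat \<Rightarrow> scheme \<Rightarrow> activity \<Rightarrow> (nat \<Rightarrow> nat) \<Rightarrow> nat \<Rightarrow> nat \<Rightarrow> real" where
  "channel_input K c s m k t = (if k \<in> active K s then enc c s k (m k) t else 0)"

definition channel_output ::
  "nat \<Rightarrow> network \<Rightarrow> nat \<Rightarrow> scheme \<Rightarrow> activity \<Rightarrow> (nat \<Rightarrow> nat) \<Rightarrow> (nat \<Rightarrow> nat \<Rightarrow> real) \<Rightarrow> nat \<Rightarrow> nat \<Rightarrow> real"
where
  "channel_output K N n c s m z k =
     (\<lambda>t\<in>{1..n}. gain N k k * channel_input K c s m k t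
        + (\<Sum>j \<in> neighbours K N k. gain N j k * channel_input K c s m j t) + z k t)"

primrec received ::
  "nat \<Rightarrow> network \<Rightarrow> scheme \<Rightarrow> activity \<Rightarrow> (nat \<Rightarrow> nat \<Rightarrow> real) \<Rightarrow> nat \<Rightarrow> nat \<Rightarrow> inbox"
where
  "received K N c s y 0 = (\<lambda>k _. undefined)"
| "received K N c s y (Suc d) = (\<lambda>k. \<lambda>(r, j) \<in> {1..Suc d} \<times> active_nbrs K N s k.
     if r = Suc d then coop c s (Suc d) j k (y j, received K N c s y d j)
     else received K N c s y d k (r, j))"

definition decoding_error ::
  "nat \<Rightarrow> network \<Rightarrow> nat \<Rightarrow> scheme \<Rightarrow> activity \<Rightarrow> (nat \<Rightarrow> nat) \<Rightarrow> (nat \<Rightarrow> nat \<Rightarrow> real) \<Rightarrow> bool"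
where
  "decoding_error K N n c s m z \<longleftrightarrow>
     (let y = channel_output K N n c s m z in
        (\<exists>k \<in> urllc K s. dec_urllc c s k (y k) \<noteq> m k) \<or>
        (\<exists>k \<in> embb K s. dec_embb c s k (y k, received K N c s y (rounds c) k) \<noteq> m k))"

definition message_pmf ::
  "nat \<Rightarrow> real \<Rightarrow> (activity \<Rightarrow> nat \<Rightarrow> real) \<Rightarrow> nat \<Rightarrow> activity \<Rightarrow> (nat \<Rightarrow> nat) pmf" where
  "message_pmf K R\<^sub>U R\<^sub>e n s =
     Pi_pmf (active K s) 0 (\<lambda>k. pmf_of_set {1..num_messages n (tx_rate K R\<^sub>U R\<^sub>e s k)})"

definition noise_measure :: "nat \<Rightarrow> nat \<Rightarrow> (nat \<Rightarrow> nat \<Rightarrow> real) measure" where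
  "noise_measure K n = (\<Pi>\<^sub>M k\<in>{1..K}. \<Pi>\<^sub>M t\<in>{1..n}. density lborel std_normal_density)"

text \<open>
  The overall error probability: the expectation over the activity of the conditional error
  probability, given which messages and noise are independent.
\<close>

definition error_prob ::
  "nat \<Rightarrow> network \<Rightarrow> real \<Rightarrow> real \<Rightarrow> real \<Rightarrow> (activity \<Rightarrow> nat \<Rightarrow> real) \<Rightarrow> nat \<Rightarrow> scheme \<Rightarrow> real"
where
  "error_prob K N \<rho> \<rho>\<^sub>f R\<^sub>U R\<^sub>e n c =
     measure_pmf.expectation (activity_pmf \<rho> \<rho>\<^sub>f K) (\<lambda>s.
       let Q = measure_pmf (message_pmf K R\<^sub>U R\<^sub>e n s) \<Otimes>\<^sub>M noise_measure K n
       in measure Q {(m, z) \<in> space Q. decoding_error K N n c s m z})"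

text \<open>The error event is measurable, so the use of \<open>measure\<close> in \<open>error_prob\<close> is meaningful.\<close>

lemma neighbours_sym: "j \<in> {1..K} \<Longrightarrow> k \<in> neighbours K N j \<Longrightarrow> j \<in> neighbours K N k"
  by (auto simp: neighbours_eq_unit_distance norm_minus_commute)

lemma measurable_channel_output:
  assumes "k \<in> {1..K}"
  shows "(\<lambda>z. channel_output K N n c s m z k) \<in> noise_measure K n \<rightarrow>\<^sub>M output_space n"
proof -
  have [measurable]: "(\<lambda>z. z k t) \<in> noise_measure K n \<rightarrow>\<^sub>M borel" if "t \<in> {1..n}" for t
  proof -
    have "(\<lambda>z. z k) \<in> noise_measure K n \<rightarrow>\<^sub>M (\<Pi>\<^sub>M t\<in>{1..n}. density lborel std_normal_density)"
      unfolding noise_measure_def using assms by (rule measurable_component_singleton)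
    moreover have "(\<lambda>f. f t) \<in> (\<Pi>\<^sub>M t\<in>{1..n}. density lborel std_normal_density)
        \<rightarrow>\<^sub>M density lborel std_normal_density"
      using that by (rule measurable_component_singleton)
    ultimately show ?thesis
      using measurable_compose by fastforce
  qed
  show ?thesis
    unfolding channel_output_def by (rule measurable_restrict) simp
qed

lemma measurable_received:
  assumes c: "valid_scheme K N \<rho> \<rho>\<^sub>f P R\<^sub>U R\<^sub>e n c" and s: "s \<in> set_pmf (activity_pmf \<rho> \<rho>\<^sub>f K)"
  shows "d \<le> rounds c \<Longrightarrow> k \<in> active K s \<Longrightarrow>
    (\<lambda>z. received K N c s (channel_output K N n c s m z) d k)
      \<in> noise_measure K n \<rightarrow>\<^sub>M inbox_space K N s d k"
proof (induction d arbitrary: k)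
  case 0
  then show ?case
    by (auto simp: inbox_space_def space_PiM intro!: measurable_const)
next
  case (Suc d)
  have "(\<lambda>z. if r = Suc d
          then coop c s (Suc d) j k (channel_output K N n c s m z j,
                 received K N c s (channel_output K N n c s m z) d j)
          else received K N c s (channel_output K N n c s m z) d k (r, j))
        \<in> noise_measure K n \<rightarrow>\<^sub>M coop_msg_space"
    if rj: "r \<in> {1..Suc d}" "j \<in> active_nbrs K N s k" for r j
  proof (cases "r = Suc d")
    case True
    have k: "k \<in> {1..K}" and j: "j \<in> active K s" "j \<in> {1..K}" "j \<in> neighbours K N k"
      using rj Suc.prems by (auto simp: active_nbrs_def active_def)
    then have "k \<in> active_nbrs K N s j"
      using Suc.prems neighbours_sym by (auto simp: active_nbrs_def)
    then have "coop c s (Suc d) j k \<in> output_space n \<Otimes>\<^sub>M inbox_space K N s d j \<rightarrow>\<^sub>M coop_msg_space"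
      using c[unfolded valid_scheme_def, rule_format, OF s] j(1) Suc.prems(1)
      by (metis (no_types, lifting) atLeastAtMost_iff diff_Suc_1 le_add1 plus_1_eq_Suc)
    moreover have "(\<lambda>z. (channel_output K N n c s m z j,
          received K N c s (channel_output K N n c s m z) d j))
        \<in> noise_measure K n \<rightarrow>\<^sub>M output_space n \<Otimes>\<^sub>M inbox_space K N s d j"
      using j Suc by (intro measurable_Pair measurable_channel_output) auto
    ultimately show ?thesis
      using True by (auto intro: measurable_compose)
  next
    case False
    then have "(r, j) \<in> {1..d} \<times> active_nbrs K N s k" using rj by auto
    moreover have "(\<lambda>z. received K N c s (channel_output K N n c s m z) d k)
        \<in> noise_measure K n \<rightarrow>\<^sub>M inbox_space K N s d k"
      using Suc by auto
    ultimately show ?thesis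
      unfolding inbox_space_def
      using False by (auto intro: measurable_compose[OF _ measurable_component_singleton])
  qed
  then show ?case
    unfolding inbox_space_def received.simps by (intro measurable_restrict) auto
qed

lemma measurable_decoding_error:
  assumes c: "valid_scheme K N \<rho> \<rho>\<^sub>f P R\<^sub>U R\<^sub>e n c" and s: "s \<in> set_pmf (activity_pmf \<rho> \<rho>\<^sub>f K)"
  defines "Q \<equiv> measure_pmf (message_pmf K R\<^sub>U R\<^sub>e n s) \<Otimes>\<^sub>M noise_measure K n"
  shows "{(m, z) \<in> space Q. decoding_error K N n c s m z} \<in> sets Q"
proof -
  let ?M = "PiE {1..K} (\<lambda>_. UNIV :: nat set)"
  let ?Z = "noise_measure K n"
  define E where "E m = {z \<in> space ?Z. decoding_error K N n c s m z}" for m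
  have "E m \<in> sets ?Z" for m
  proof -
    have "Measurable.pred ?Z (\<lambda>z. dec_urllc c s k (channel_output K N n c s m z k) = m k)"
      if "k \<in> urllc K s" for k
    proof -
      have k: "k \<in> {1..K}" using that by (auto simp: urllc_def)
      have "dec_urllc c s k \<in> output_space n \<rightarrow>\<^sub>M count_space UNIV"
        using c s that unfolding valid_scheme_def by blast
      from measurable_compose[OF measurable_channel_output[OF k] this]
      show ?thesis by measurable
    qed
    moreover have "Measurable.pred ?Z (\<lambda>z. dec_embb c s k (channel_output K N n c s m z k,
        received K N c s (channel_output K N n c s m z) (rounds c) k) = m k)"
      if "k \<in> embb K s" for k
    proof -
      have k: "k \<in> {1..K}" "k \<in> active K s" using that by (auto simp: embb_def active_def)
      have "dec_embb c s k \<in> output_space n \<Otimes>\<^sub>M inbox_space K N s (rounds c) k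
          \<rightarrow>\<^sub>M count_space UNIV"
        using c s that unfolding valid_scheme_def by blast
      from measurable_compose[OF measurable_Pair[OF measurable_channel_output[OF k(1)]
          measurable_received[OF c s order.refl k(2)]] this]
      show ?thesis by measurable
    qed
    moreover have "finite (urllc K s)" "finite (embb K s)"
      by (auto simp: urllc_def embb_def active_def)
    ultimately have "Measurable.pred ?Z (decoding_error K N n c s m)"
      unfolding decoding_error_def Let_def
      by (intro pred_intros_logic pred_intros_finite) auto
    then show ?thesis by (simp add: E_def pred_def)
  qed
  moreover have "{(m, z) \<in> space Q. decoding_error K N n c s m z} =
      (\<Union>m0\<in>?M. {m. restrict m {1..K} = m0} \<times> E m0)"
  proof -
    have inp: "channel_input K c s (restrict m {1..K}) = channel_input K c s m" for m
      by (auto simp: channel_input_def active_def fun_eq_iff)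
    have out: "channel_output K N n c s (restrict m {1..K}) z = channel_output K N n c s m z" for m z
      unfolding channel_output_def inp ..
    have "k \<in> {1..K}" if "k \<in> urllc K s \<or> k \<in> embb K s" for k
      using that by (auto simp: urllc_def embb_def active_def)
    then have "decoding_error K N n c s (restrict m {1..K}) z = decoding_error K N n c s m z" for m z
      unfolding decoding_error_def out Let_def by (metis restrict_apply')
    moreover have "restrict m {1..K} \<in> ?M" for m :: "nat \<Rightarrow> nat" by simp
    ultimately show ?thesis
      by (auto simp: Q_def space_pair_measure E_def)
  qed
  moreover have "countable ?M" by (rule countable_PiE) auto
  ultimately show ?thesis
    unfolding Q_def by (auto intro!: sets.countable_UN' pair_measureI)
qed


section \<open>Achievability and the multiplexing gain region\<close>

definition achievable_rates ::
  "nat \<Rightarrow> network \<Rightarrow> real \<Rightarrow> real \<Rightarrow> real \<Rightarrow> real \<Rightarrow> real \<Rightarrow> bool"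
where
  "achievable_rates K N \<rho> \<rho>\<^sub>f P R\<^sub>U Rbar \<longleftrightarrow>
     0 \<le> R\<^sub>U \<and> 0 \<le> Rbar \<and>
     (\<exists>R\<^sub>e :: activity \<Rightarrow> nat \<Rightarrow> real.
        (\<forall>s. \<forall>k \<in> embb K s. 0 \<le> R\<^sub>e s k) \<and>
        Rbar \<le> measure_pmf.expectation (activity_pmf \<rho> \<rho>\<^sub>f K)
                 (\<lambda>s. (1 / real K) * (\<Sum>k \<in> embb K s. R\<^sub>e s k)) \<and>
        (\<exists>c :: nat \<Rightarrow> scheme.
           (\<forall>n \<ge> 1. valid_scheme K N \<rho> \<rho>\<^sub>f P R\<^sub>U R\<^sub>e n (c n)) \<and>
           (\<lambda>n. error_prob K N \<rho> \<rho>\<^sub>f R\<^sub>U R\<^sub>e n (c n)) \<longlonglongrightarrow> 0))"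

text \<open>Here \<open>N K\<close> is the network with \<open>K\<close> cells. Rates are in bits, hence the binary logarithm.\<close>

definition achievable_MG :: "(nat \<Rightarrow> network) \<Rightarrow> real \<Rightarrow> real \<Rightarrow> real \<Rightarrow> real \<Rightarrow> bool" where
  "achievable_MG N \<rho> \<rho>\<^sub>f S\<^sub>U S\<^sub>e \<longleftrightarrow>
     (\<exists>(R\<^sub>U :: nat \<Rightarrow> real \<Rightarrow> real) (Rbar :: nat \<Rightarrow> real \<Rightarrow> real).
        (\<forall>K \<ge> 1. \<forall>P > 0. achievable_rates K (N K) \<rho> \<rho>\<^sub>f P (R\<^sub>U K P) (Rbar K P)) \<and>
        ereal S\<^sub>U = ereal (\<rho> * \<rho>\<^sub>f) * limsup (\<lambda>K. Limsup at_top
                      (\<lambda>P. ereal (R\<^sub>U K P / (1/2 * log 2 P)))) \<and>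
        ereal S\<^sub>e = limsup (\<lambda>K. Limsup at_top
                      (\<lambda>P. ereal (Rbar K P / (1/2 * log 2 P)))))"

definition MG_region :: "(nat \<Rightarrow> network) \<Rightarrow> real \<Rightarrow> real \<Rightarrow> (real \<times> real) set" where
  "MG_region N \<rho> \<rho>\<^sub>f = closure {(S\<^sub>U, S\<^sub>e). achievable_MG N \<rho> \<rho>\<^sub>f S\<^sub>U S\<^sub>e}"

end

theory Submission
  imports Defs
begin

text \<open>
  Colour cell \<open>k\<close> by \<open>a\<^sub>k + b\<^sub>k\<close> modulo 3, so that adjacent cells have different colours and a
  cell has at most three neighbours of each other colour. Three phases of relative length \<open>a\<close>
  each serve the URLLC Txs of one colour: these and those eMBB Txs none of whose neighbours is such
  a URLLC Tx transmit, and everybody else is silent. A last phase of relative length \<open>1 - 3 a\<close>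
  serves eMBB only. URLLC Rxs then see no interference. The eMBB Rxs invert the channel matrix of the
  transmitting cells, which is nonsingular by genericity, as a polynomial in that matrix; its powers
  applied to the outputs are computed with one exchange between neighbours per power. Over the
  resulting interference-free channels with bounded noise gain, a Gilbert--Varshamov code of integer
  points has a rate within a constant of \<open>1/2 log P\<close>.
\<close>

section \<open>Inversion of the channel by local exchanges\<close>

text \<open>The schedule answers two constraints. A URLLC Rx decodes before any cooperation, so it
  is served while its neighbours are silent; and all URLLC messages share one rate that must not
  depend on the activity, so the three colours get equal shares \<open>a\<close>. Both bounds of the
  region can then be read off. \<open>a \<le> 1/3\<close> is the bound on the URLLC gain
  \<open>\<rho> * \<rho>\<^sub>f * a\<close>. An eMBB cell can be silenced only in the phases of the
  two colours other than its own, each time with probability at most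
  \<open>1 - (1 - \<rho> * \<rho>\<^sub>f) ^ 3\<close>; the resulting expected loss is L times the
  URLLC gain. The polynomial form of the inverse makes every cooperation round the same local step,
  so no routing of outputs through the network has to be described. Genericity for every set of
  cells is what allows the set of senders to change with the phase and the activity. Only terms that
  grow with \<open>log 2 P\<close> count. Noise gain, packing loss and rounding cost a bounded rate,
  so crude estimates of the noise energy and a crude packing suffice.\<close>

lemma linear_dependence:
  fixes v :: "'i \<Rightarrow> 'x \<Rightarrow> real"
  assumes "finite X" "finite J" "card X < card J"
  shows "\<exists>a. (\<exists>i\<in>J. a i \<noteq> 0) \<and> (\<forall>x\<in>X. (\<Sum>i\<in>J. a i * v i x) = 0)"
  using assms
proof (induction X arbitrary: J v rule: finite_induct)
  case empty
  then obtain i where "i \<in> J" by (metis card.empty card_gt_0_iff equals0I)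
  then show ?case by (intro exI[of _ "\<lambda>_. 1"]) auto
next
  case (insert x0 X)
  show ?case
  proof (cases "\<forall>i\<in>J. v i x0 = 0")
    case True
    have "card X < card J" using insert by simp
    from insert.IH[OF insert.prems(1) this, of v] obtain a
      where "\<exists>i\<in>J. a i \<noteq> 0" "\<forall>x\<in>X. (\<Sum>i\<in>J. a i * v i x) = 0" by blast
    with True show ?thesis by (intro exI[of _ a]) auto
  next
    case False
    \<comment> \<open>\<open>p\<close> is the pivot: subtracting its multiples clears the coordinate
      \<open>x0\<close> from the other vectors, which leaves one vector and one coordinate
      fewer.\<close>
    then obtain p where p: "p \<in> J" "v p x0 \<noteq> 0" by blast
    define J' where "J' = J - {p}"
    have J': "finite J'" "card X < card J'"
      using insert p by (auto simp: J'_def card_Diff_singleton)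
    define b where "b i = v i x0 / v p x0" for i
    from insert.IH[OF J', of "\<lambda>i x. v i x - b i * v p x"] obtain a
      where a: "\<exists>i\<in>J'. a i \<noteq> 0" "\<forall>x\<in>X. (\<Sum>i\<in>J'. a i * (v i x - b i * v p x)) = 0" by blast
    \<comment> \<open>The pivot's coefficient collects the subtracted multiples, so that both
      combinations agree in every coordinate.\<close>
    define a' where "a' = a(p := - (\<Sum>i\<in>J'. a i * b i))"
    have *: "(\<Sum>i\<in>J. a' i * v i x) = (\<Sum>i\<in>J'. a i * (v i x - b i * v p x))" for x
    proof -
      have "(\<Sum>i\<in>J. a' i * v i x) = a' p * v p x + (\<Sum>i\<in>J'. a' i * v i x)"
        unfolding J'_def using p(1) insert.prems(1) by (simp add: sum.remove)
      also have "(\<Sum>i\<in>J'. a' i * v i x) = (\<Sum>i\<in>J'. a i * v i x)"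
        by (intro sum.cong) (auto simp: a'_def J'_def)
      finally show ?thesis
        by (simp add: a'_def right_diff_distrib sum_subtractf sum_distrib_right mult.assoc)
    qed
    have "a i * (v i x0 - b i * v p x0) = 0" for i using p by (simp add: b_def)
    then have "(\<Sum>i\<in>J. a' i * v i x0) = 0" unfolding * by (intro sum.neutral ballI)
    moreover have "\<exists>i\<in>J. a' i \<noteq> 0" using a(1) by (auto simp: a'_def J'_def)
    ultimately show ?thesis using a(2) * by (intro exI[of _ a']) auto
  qed
qed

text \<open>Vectors indexed by \<open>T\<close> are encoded as functions on all of
  \<open>nat\<close> that vanish outside \<open>T\<close>; this lets the operator be iterated with
  \<open>^^\<close>. Evaluating it at \<open>k\<close> takes only values held at \<open>k\<close>
  and at its neighbours.\<close>

definition net_op :: "nat \<Rightarrow> network \<Rightarrow> nat set \<Rightarrow> (nat \<Rightarrow> real) \<Rightarrow> nat \<Rightarrow> real" where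
  "net_op K N T x k =
     (if k \<in> T then gain N k k * x k + (\<Sum>j \<in> neighbours K N k \<inter> T. gain N j k * x j) else 0)"

lemma net_op_sum:
  "net_op K N T (\<lambda>k. \<Sum>i\<in>I. a i * f i k) = (\<lambda>k. \<Sum>i\<in>I. a i * net_op K N T (f i) k)"
proof
  fix k
  have "(\<Sum>j\<in>neighbours K N k \<inter> T. gain N j k * (\<Sum>i\<in>I. a i * f i j)) =
      (\<Sum>i\<in>I. a i * (\<Sum>j\<in>neighbours K N k \<inter> T. gain N j k * f i j))"
    unfolding sum_distrib_left by (subst sum.swap) (simp add: mult_ac)
  then show "net_op K N T (\<lambda>k. \<Sum>i\<in>I. a i * f i k) k = (\<Sum>i\<in>I. a i * net_op K N T (f i) k)"
    by (simp add: net_op_def ring_distribs sum.distrib sum_distrib_left mult_ac)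
qed

lemma net_op_pow_sum:
  "(net_op K N T ^^ d) (\<lambda>k. \<Sum>i\<in>I. a i * f i k) = (\<lambda>k. \<Sum>i\<in>I. a i * (net_op K N T ^^ d) (f i) k)"
  by (induction d) (simp_all add: net_op_sum)

lemma net_op_pow_outside:
  assumes "\<And>k. k \<notin> T \<Longrightarrow> x k = 0" "k \<notin> T"
  shows "(net_op K N T ^^ d) x k = 0"
  using assms by (cases d) (auto simp: net_op_def)

lemma net_op_pow_expand:
  assumes "finite T" "\<And>k. k \<notin> T \<Longrightarrow> x k = 0"
  shows "(net_op K N T ^^ d) x k =
    (\<Sum>j\<in>T. x j * (net_op K N T ^^ d) (\<lambda>i. if i = j then 1 else 0) k)"
proof -
  have "x = (\<lambda>k. \<Sum>j\<in>T. x j * (if k = j then 1 else 0))"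
    using assms by (auto simp: if_distrib cong: if_cong)
  then have "(net_op K N T ^^ d) x k =
      (net_op K N T ^^ d) (\<lambda>k. \<Sum>j\<in>T. x j * (if k = j then 1 else 0)) k"
    by simp
  then show ?thesis unfolding net_op_pow_sum .
qed

text \<open>
  The powers of an injective operator on a finite-dimensional space are linearly dependent;
  cancelling the lowest power that occurs in a relation expresses the identity as a combination
  of positive powers.
\<close>

lemma net_op_inverse:
  assumes gen: "generic_gains K N" and T: "T \<subseteq> {1..K}"
  shows "\<exists>c. \<forall>x. (\<forall>k. k \<notin> T \<longrightarrow> x k = 0) \<longrightarrow>
    (\<forall>k. (\<Sum>d<K * K. c d * (net_op K N T ^^ Suc d) x k) = x k)"
proof -
  let ?H = "net_op K N T"
  let ?e = "\<lambda>j i. if i = j then 1 else (0::real)"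
  have fin: "finite T" using T finite_subset by blast
  have inj: "x k = 0" if "\<And>k. k \<notin> T \<Longrightarrow> x k = 0" "\<And>k. ?H x k = 0" for x k
  proof (cases "k \<in> T")
    case True
    have "\<forall>k\<in>T. gain N k k * x k + (\<Sum>j \<in> neighbours K N k \<inter> T. gain N j k * x j) = 0"
      using that(2) unfolding net_op_def by metis
    then show ?thesis using gen T True unfolding generic_gains_def by blast
  qed (use that in auto)
  have injpow: "x k = 0" if "\<And>k. k \<notin> T \<Longrightarrow> x k = 0" "\<And>k. (?H ^^ d) x k = 0" for x k d
    using that
  proof (induction d)
    case (Suc d)
    show ?case
    proof (rule Suc.IH)
      show "(?H ^^ d) x k = 0" for k
      proof (rule inj[of "(?H ^^ d) x"])
        show "(?H ^^ d) x k = 0" if "k \<notin> T" for k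
          using Suc.prems(1) that by (rule net_op_pow_outside)
        show "?H ((?H ^^ d) x) k = 0" for k
          using Suc.prems(2)[of k] by simp
      qed
    qed (rule Suc.prems(1))
  qed simp
  \<comment> \<open>The powers with exponents 0 to \<open>K * K\<close> are one more than the
    entries of a matrix over \<open>{1..K}\<close>.\<close>
  have "card ({1..K} \<times> {1..K}) < card {..K * K}" by simp
  from linear_dependence[OF _ _ this, of "\<lambda>i (j, k). (?H ^^ i) (?e j) k"]
  obtain a where a: "\<exists>i\<in>{..K * K}. a i \<noteq> 0"
    "\<And>j k. j \<in> {1..K} \<Longrightarrow> k \<in> {1..K} \<Longrightarrow> (\<Sum>i\<le>K * K. a i * (?H ^^ i) (?e j) k) = 0"
    by fastforce
  define p where "p = (LEAST i. a i \<noteq> 0)"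
  have p: "a p \<noteq> 0" "p \<le> K * K" "\<And>i. i < p \<Longrightarrow> a i = 0"
  proof -
    from a(1) obtain i where i: "i \<le> K * K" "a i \<noteq> 0" by auto
    then show "a p \<noteq> 0" unfolding p_def by (metis (mono_tags) LeastI)
    show "p \<le> K * K" unfolding p_def using i Least_le[of "\<lambda>i. a i \<noteq> 0" i] by linarith
    show "a i = 0" if "i < p" for i using that not_less_Least unfolding p_def by blast
  qed
  \<comment> \<open>The zero branch pads the polynomial to a length that depends neither on
    \<open>p\<close> nor on \<open>T\<close>, so that one number of rounds serves all sender
    sets.\<close>
  define c where "c d = (if p + Suc d \<le> K * K then - a (p + Suc d) / a p else 0)" for d
  have "(\<Sum>d<K * K. c d * (?H ^^ Suc d) x k) = x k" if x: "\<And>k. k \<notin> T \<Longrightarrow> x k = 0" for x k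
  proof -
    have rel: "(\<Sum>i\<le>K * K. a i * (?H ^^ i) x k) = 0" for k
    proof (cases "k \<in> T")
      case True
      have "(\<Sum>i\<le>K * K. a i * (?H ^^ i) x k) =
          (\<Sum>i\<le>K * K. \<Sum>j\<in>T. x j * (a i * (?H ^^ i) (?e j) k))"
        by (intro sum.cong refl, subst net_op_pow_expand[OF fin x])
          (auto simp: sum_distrib_left mult_ac)
      also have "\<dots> = (\<Sum>j\<in>T. x j * (\<Sum>i\<le>K * K. a i * (?H ^^ i) (?e j) k))"
        by (subst sum.swap) (simp add: sum_distrib_left)
      also have "\<dots> = 0" using a(2)[OF subsetD[OF T] subsetD[OF T]] True by simp
      finally show ?thesis .
    qed (simp add: net_op_pow_outside x)
    \<comment> \<open>\<open>w\<close> is the relation with the factor \<open>?H ^^ p\<close>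
      removed. Injectivity of that power forces \<open>w\<close> to vanish, and its lowest term is
      \<open>a p * x k\<close>.\<close>
    define w where "w k = (\<Sum>d\<in>{p..K * K}. a d * (?H ^^ (d - p)) x k)" for k
    have "w k = 0" for k
    proof (rule injpow[of w p])
      show "w k = 0" if "k \<notin> T" for k
        using that x by (simp add: w_def net_op_pow_outside)
      have "(?H ^^ p) w k = (\<Sum>d\<in>{p..K * K}. a d * (?H ^^ d) x k)" for k
        unfolding w_def[abs_def] net_op_pow_sum
        by (intro sum.cong refl) (auto simp: funpow_add[symmetric] simp flip: comp_apply[of "?H ^^ p"])
      also have "\<dots> k = (\<Sum>i\<le>K * K. a i * (?H ^^ i) x k)" for k
        by (rule sum.mono_neutral_left) (use p in auto)
      finally show "(?H ^^ p) w k = 0" for k using rel by simp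
    qed
    moreover define Z where "Z = (\<Sum>d\<in>{Suc p..K * K}. a d * (?H ^^ (d - p)) x k)"
    have "w k = a p * x k + Z"
      unfolding w_def Z_def using p(2) by (subst sum.atLeast_Suc_atMost) auto
    ultimately have "- Z / a p = x k" using p(1) by (simp add: field_simps)
    moreover have "(\<Sum>d<K * K. c d * (?H ^^ Suc d) x k) =
        (\<Sum>d\<in>{Suc p..K * K}. - a d / a p * (?H ^^ (d - p)) x k)"
    proof -
      have "(\<Sum>d<K * K. c d * (?H ^^ Suc d) x k) =
          (\<Sum>d<K * K - p. - a (p + Suc d) / a p * (?H ^^ Suc d) x k)"
        by (rule sum.mono_neutral_cong_right) (auto simp: c_def)
      also have "\<dots> = (\<Sum>d\<in>{Suc p..K * K}. - a d / a p * (?H ^^ (d - p)) x k)"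
        by (rule sum.reindex_bij_witness[where i = "\<lambda>d. d - Suc p" and j = "\<lambda>d. d + Suc p"])
           (auto simp: add_ac Suc_diff_le simp del: funpow.simps)
      finally show ?thesis .
    qed
    moreover have "(\<Sum>d\<in>{Suc p..K * K}. - a d / a p * (?H ^^ (d - p)) x k) = - Z / a p"
      by (simp add: Z_def sum_divide_distrib sum_negf)
    ultimately show ?thesis by (simp only:)
  qed
  then show ?thesis by blast
qed

section \<open>Noise gain of the inverted channel\<close>

lemma net_op_add: "net_op K N T (\<lambda>k. x k + y k) = (\<lambda>k. net_op K N T x k + net_op K N T y k)"
  by (auto simp: net_op_def ring_distribs sum.distrib fun_eq_iff)

lemma net_op_pow_add:
  "(net_op K N T ^^ d) (\<lambda>k. x k + y k) = (\<lambda>k. (net_op K N T ^^ d) x k + (net_op K N T ^^ d) y k)"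
  by (induction d) (simp_all add: net_op_add)

text \<open>The outputs already contain one application of the operator, so an inverse in positive
  powers becomes a polynomial starting at power zero on the outputs. What is left of the noise is a
  fixed linear form in \<open>z\<close>, bounded by Cauchy-Schwarz. Since \<open>G\<close> does not
  involve the power, the inversion costs only a bounded rate.\<close>

lemma zero_forcing:
  assumes gen: "generic_gains K N"
  shows "\<exists>C G. 0 \<le> G \<and> (\<forall>T\<subseteq>{1..K}. \<forall>x z. \<forall>k\<in>T.
    (\<forall>j. j \<notin> T \<longrightarrow> x j = 0) \<longrightarrow> (\<forall>j. j \<notin> T \<longrightarrow> z j = 0) \<longrightarrow>
    ((\<Sum>d<K * K. C T d * (net_op K N T ^^ d) (\<lambda>j. net_op K N T x j + z j) k) - x k)\<^sup>2
      \<le> G * (\<Sum>j\<in>{1..K}. (z j)\<^sup>2))"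
proof -
  define C where "C T = (SOME c. \<forall>x. (\<forall>k. k \<notin> T \<longrightarrow> x k = 0) \<longrightarrow>
    (\<forall>k. (\<Sum>d<K * K. c d * (net_op K N T ^^ Suc d) x k) = x k))" for T
  have C: "(\<Sum>d<K * K. C T d * (net_op K N T ^^ Suc d) x k) = x k"
    if "T \<subseteq> {1..K}" "\<forall>k. k \<notin> T \<longrightarrow> x k = 0" for T x k
    using someI_ex[OF net_op_inverse[OF gen that(1)]] that(2) unfolding C_def by blast
  define a where "a T j k = (\<Sum>d<K * K. C T d * (net_op K N T ^^ d) (\<lambda>i. if i = j then 1 else 0) k)"
    for T j k
  \<comment> \<open>Summing over all sender sets and all cells gives one constant for every activity
    and every time.\<close>
  define G where "G = (\<Sum>T\<in>Pow {1..K}. \<Sum>k\<in>{1..K}. \<Sum>j\<in>T. (a T j k)\<^sup>2)"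
  have "((\<Sum>d<K * K. C T d * (net_op K N T ^^ d) (\<lambda>j. net_op K N T x j + z j) k) - x k)\<^sup>2
      \<le> G * (\<Sum>j\<in>{1..K}. (z j)\<^sup>2)"
    if T: "T \<subseteq> {1..K}" and k: "k \<in> T" and x: "\<forall>j. j \<notin> T \<longrightarrow> x j = 0" and z: "\<forall>j. j \<notin> T \<longrightarrow> z j = 0"
    for T x z k
  proof -
    have fin: "finite T" using T finite_subset by blast
    have "(\<Sum>d<K * K. C T d * (net_op K N T ^^ d) (\<lambda>j. net_op K N T x j + z j) k) =
        (\<Sum>d<K * K. C T d * (net_op K N T ^^ Suc d) x k) + (\<Sum>d<K * K. C T d * (net_op K N T ^^ d) z k)"
      unfolding net_op_pow_add by (simp add: ring_distribs sum.distrib funpow_swap1)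
    also have "(\<Sum>d<K * K. C T d * (net_op K N T ^^ Suc d) x k) = x k"
      using T x by (rule C)
    also have "(\<Sum>d<K * K. C T d * (net_op K N T ^^ d) z k) =
        (\<Sum>d<K * K. \<Sum>j\<in>T. z j * (C T d * (net_op K N T ^^ d) (\<lambda>i. if i = j then 1 else 0) k))"
      using z by (intro sum.cong refl, subst net_op_pow_expand[OF fin])
        (auto simp: sum_distrib_left mult_ac)
    also have "\<dots> = (\<Sum>j\<in>T. z j * a T j k)"
      by (subst sum.swap) (simp add: a_def sum_distrib_left)
    finally have "((\<Sum>d<K * K. C T d * (net_op K N T ^^ d) (\<lambda>j. net_op K N T x j + z j) k) - x k)\<^sup>2
        = (\<Sum>j\<in>T. a T j k * z j)\<^sup>2"
      by (simp add: mult_ac)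
    also have "\<dots> \<le> (\<Sum>j\<in>T. (a T j k)\<^sup>2) * (\<Sum>j\<in>T. (z j)\<^sup>2)"
      by (rule Cauchy_Schwarz_ineq_sum)
    also have "\<dots> \<le> G * (\<Sum>j\<in>{1..K}. (z j)\<^sup>2)"
    proof (intro mult_mono)
      have "(\<Sum>j\<in>T. (a T j k)\<^sup>2) \<le> (\<Sum>k\<in>{1..K}. \<Sum>j\<in>T. (a T j k)\<^sup>2)"
        using T k by (intro member_le_sum sum_nonneg) auto
      also have "\<dots> \<le> G" unfolding G_def
        using T by (intro member_le_sum[where f = "\<lambda>T. \<Sum>k\<in>{1..K}. \<Sum>j\<in>T. (a T j k)\<^sup>2"] sum_nonneg) auto
      finally show "(\<Sum>j\<in>T. (a T j k)\<^sup>2) \<le> G" .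
      show "(\<Sum>j\<in>T. (z j)\<^sup>2) \<le> (\<Sum>j\<in>{1..K}. (z j)\<^sup>2)" using T by (intro sum_mono2) auto
    qed (auto simp: G_def intro!: sum_nonneg)
    finally show ?thesis .
  qed
  moreover have "0 \<le> G" by (auto simp: G_def intro!: sum_nonneg)
  ultimately show ?thesis by blast
qed

section \<open>Integer codes\<close>

text \<open>Subtraction on \<open>nat\<close> is truncated, so the exponent is the distance between
  \<open>x\<close> and \<open>c\<close>; each side of \<open>c\<close> is dominated by a geometric
  series with sum 2.\<close>

lemma sum_half_power_dist_le: "(\<Sum>x<q. (1/2::real) ^ ((x - c) + (c - x))) \<le> 4" for c q :: nat
proof -
  have geo: "(\<Sum>i<m. (1/2::real) ^ i) \<le> 2" for m
    by (simp add: sum_gp_strict)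
  have "(\<Sum>x<q. (1/2::real) ^ ((x - c) + (c - x))) =
      (\<Sum>x\<in>{..<q} \<inter> {..<c}. (1/2::real) ^ (c - x)) + (\<Sum>x\<in>{..<q} - {..<c}. (1/2::real) ^ (x - c))"
    by (subst sum.Int_Diff[where B = "{..<c}"]) (auto intro!: arg_cong2[where f = "(+)"] sum.cong)
  also have "(\<Sum>x\<in>{..<q} \<inter> {..<c}. (1/2::real) ^ (c - x)) \<le> (\<Sum>i<Suc c. (1/2) ^ i)"
  proof -
    have "(\<Sum>x\<in>{..<q} \<inter> {..<c}. (1/2::real) ^ (c - x)) =
        (\<Sum>i\<in>(\<lambda>x. c - x) ` ({..<q} \<inter> {..<c}). (1/2) ^ i)"
      by (subst sum.reindex) (auto simp: inj_on_def)
    also have "\<dots> \<le> (\<Sum>i<Suc c. (1/2) ^ i)"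
      by (rule sum_mono2) auto
    finally show ?thesis .
  qed
  also have "(\<Sum>x\<in>{..<q} - {..<c}. (1/2::real) ^ (x - c)) \<le> (\<Sum>i<q. (1/2) ^ i)"
  proof -
    have "(\<Sum>x\<in>{..<q} - {..<c}. (1/2::real) ^ (x - c)) =
        (\<Sum>i\<in>(\<lambda>x. x - c) ` ({..<q} - {..<c}). (1/2) ^ i)"
      by (subst sum.reindex) (auto simp: inj_on_def)
    also have "\<dots> \<le> (\<Sum>i<q. (1/2) ^ i)"
      by (rule sum_mono2) auto
    finally show ?thesis .
  qed
  finally show ?thesis using geo[of "Suc c"] geo[of q] by linarith
qed

text \<open>The count uses the weight \<open>2 ^ - |x - c|\<^sub>1\<close> and \<open>|x - c|\<^sub>1 \<le> |x - c|\<^sub>2\<^sup>2\<close> on integer points.\<close>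

lemma card_grid_ball_le:
  fixes c :: "'t \<Rightarrow> nat"
  assumes S: "finite S"
  shows "real (card {x \<in> S \<rightarrow>\<^sub>E {..<q}. (\<Sum>t\<in>S. (real (x t) - real (c t))\<^sup>2) \<le> real r})
    \<le> 2 ^ r * 4 ^ card S"
proof -
  let ?B = "{x \<in> S \<rightarrow>\<^sub>E {..<q}. (\<Sum>t\<in>S. (real (x t) - real (c t))\<^sup>2) \<le> real r}"
  define dst where "dst x t = (x t - c t) + (c t - x t)" for x t
  have fin: "finite (S \<rightarrow>\<^sub>E {..<q})" using S by (intro finite_PiE) auto
  have one: "1 \<le> 2 ^ r * (\<Prod>t\<in>S. (1/2::real) ^ dst x t)" if "x \<in> ?B" for x
  proof -
    have "real (dst x t) \<le> (real (x t) - real (c t))\<^sup>2" for t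
    proof -
      have "dst x t * 1 \<le> dst x t * dst x t"
        by (cases "dst x t = 0") auto
      then have "real (dst x t) \<le> (real (dst x t))\<^sup>2"
        unfolding power2_eq_square by (metis of_nat_le_iff of_nat_mult mult.right_neutral)
      also have "(real (dst x t))\<^sup>2 = (real (x t) - real (c t))\<^sup>2"
        by (cases "c t \<le> x t") (auto simp: dst_def of_nat_diff power2_commute)
      finally show ?thesis .
    qed
    then have "real (\<Sum>t\<in>S. dst x t) \<le> (\<Sum>t\<in>S. (real (x t) - real (c t))\<^sup>2)"
      by (simp add: sum_mono)
    also have "\<dots> \<le> real r" using that by blast
    finally have "(\<Sum>t\<in>S. dst x t) \<le> r" by (simp only: of_nat_le_iff)
    then have "(1/2::real) ^ r \<le> (1/2) ^ (\<Sum>t\<in>S. dst x t)"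
      by (intro power_decreasing) auto
    then have "1 \<le> 2 ^ r * (1/2::real) ^ (\<Sum>t\<in>S. dst x t)"
      by (simp add: power_one_over field_simps)
    then show ?thesis by (simp add: power_sum)
  qed
  \<comment> \<open>Each point of the ball has weight at least \<open>(1/2) ^ r\<close>. Over the
    whole grid the weight factors into coordinates, each contributing at most 4.\<close>
  have "real (card ?B) \<le> (\<Sum>x\<in>?B. 2 ^ r * (\<Prod>t\<in>S. (1/2::real) ^ dst x t))"
    using sum_mono[of ?B "\<lambda>_. 1::real", OF one] by simp
  also have "\<dots> \<le> (\<Sum>x\<in>S \<rightarrow>\<^sub>E {..<q}. 2 ^ r * (\<Prod>t\<in>S. (1/2::real) ^ dst x t))"
    using fin by (intro sum_mono2) (auto intro!: mult_nonneg_nonneg prod_nonneg)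
  also have "\<dots> = 2 ^ r * (\<Prod>t\<in>S. \<Sum>x<q. (1/2::real) ^ ((x - c t) + (c t - x)))"
    unfolding sum_distrib_left[symmetric] dst_def using S
    by (subst prod_sum_PiE) auto
  also have "\<dots> \<le> 2 ^ r * (\<Prod>t\<in>S. 4)"
    by (intro mult_left_mono prod_mono) (auto intro: sum_half_power_dist_le sum_nonneg)
  finally show ?thesis by simp
qed

text \<open>Greedy choice: while the balls around the points chosen so far cannot fill the grid, a
  point outside all of them can be added.\<close>

lemma grid_code:
  fixes S :: "'t set" and q :: nat
  assumes S: "finite S"
  shows "real M * (2 ^ r * 4 ^ card S) \<le> real q ^ card S \<Longrightarrow>
    \<exists>u :: nat \<Rightarrow> 't \<Rightarrow> nat. (\<forall>m\<in>{1..M}. u m \<in> S \<rightarrow>\<^sub>E {..<q}) \<and>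
      (\<forall>m\<in>{1..M}. \<forall>m'\<in>{1..M}. m \<noteq> m' \<longrightarrow>
        real r < (\<Sum>t\<in>S. (real (u m t) - real (u m' t))\<^sup>2))"
proof (induction M)
  case (Suc M)
  have "real M * (2 ^ r * 4 ^ card S) \<le> real (Suc M) * (2 ^ r * 4 ^ card S)"
    by (intro mult_right_mono) auto
  with Suc.prems have "real M * (2 ^ r * 4 ^ card S) \<le> real q ^ card S"
    by linarith
  from Suc.IH[OF this] obtain u :: "nat \<Rightarrow> 't \<Rightarrow> nat" where
    u: "\<And>m. m \<in> {1..M} \<Longrightarrow> u m \<in> S \<rightarrow>\<^sub>E {..<q}"
    "\<And>m m'. m \<in> {1..M} \<Longrightarrow> m' \<in> {1..M} \<Longrightarrow> m \<noteq> m' \<Longrightarrow>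
        real r < (\<Sum>t\<in>S. (real (u m t) - real (u m' t))\<^sup>2)"
    by blast
  define B where "B m = {x \<in> S \<rightarrow>\<^sub>E {..<q}. (\<Sum>t\<in>S. (real (x t) - real (u m t))\<^sup>2) \<le> real r}" for m
  have fin: "finite (S \<rightarrow>\<^sub>E {..<q})" using S by (intro finite_PiE) auto
  then have finB: "finite (\<Union>m\<in>{1..M}. B m)" by (auto simp: B_def)
  have "real (card (\<Union>m\<in>{1..M}. B m)) \<le> real (\<Sum>m\<in>{1..M}. card (B m))"
    by (intro of_nat_mono card_UN_le) auto
  also have "\<dots> \<le> (\<Sum>m\<in>{1..M}. 2 ^ r * 4 ^ card S)"
    unfolding of_nat_sum B_def by (intro sum_mono card_grid_ball_le S)
  also have "\<dots> < real (Suc M) * (2 ^ r * 4 ^ card S)"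
    by (simp add: mult_right_mono)
  also have "\<dots> \<le> real q ^ card S" by (rule Suc.prems)
  also have "\<dots> = real (card (S \<rightarrow>\<^sub>E {..<q}))" using S by (simp add: card_PiE)
  finally have "card (\<Union>m\<in>{1..M}. B m) < card (S \<rightarrow>\<^sub>E {..<q})" by simp
  then have "\<not> (S \<rightarrow>\<^sub>E {..<q}) \<subseteq> (\<Union>m\<in>{1..M}. B m)"
    using card_mono[OF finB, of "S \<rightarrow>\<^sub>E {..<q}"] by linarith
  then obtain x where x: "x \<in> S \<rightarrow>\<^sub>E {..<q}" "\<And>m. m \<in> {1..M} \<Longrightarrow> x \<notin> B m" by blast
  have far: "real r < (\<Sum>t\<in>S. (real (x t) - real (u m t))\<^sup>2)" if "m \<in> {1..M}" for m
    using x that by (auto simp: B_def not_le)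
  then have far': "real r < (\<Sum>t\<in>S. (real (u m t) - real (x t))\<^sup>2)" if "m \<in> {1..M}" for m
    using that by (subst power2_commute) simp
  show ?case
  proof (intro exI[of _ "u(Suc M := x)"] conjI ballI impI)
    fix m assume "m \<in> {1..Suc M}"
    then show "(u(Suc M := x)) m \<in> S \<rightarrow>\<^sub>E {..<q}"
      using u(1)[of m] x(1) by (cases "m = Suc M") auto
  qed (use u(2) far far' in \<open>auto simp: le_Suc_eq\<close>)
qed auto

section \<open>Gaussian noise\<close>

abbreviation std_gauss :: "real measure" where
  "std_gauss \<equiv> density lborel std_normal_density"

lemma prob_space_std_gauss: "prob_space std_gauss"
  by (rule prob_space_normal_density) simp

lemma prob_space_noise_measure: "prob_space (noise_measure K n)"
  unfolding noise_measure_def by (intro prob_space_PiM prob_space_std_gauss)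

text \<open>The factor \<open>exp (x\<^sup>2 / 4)\<close> halves the exponent of the density, which
  turns it into \<open>sqrt 2\<close> times the centred normal density of variance 2.\<close>

lemma nn_integral_std_gauss_exp_square:
  "(\<integral>\<^sup>+x. ennreal (exp (x\<^sup>2 / 4)) \<partial>std_gauss) = ennreal (sqrt 2)"
proof -
  have *: "std_normal_density x * exp (x\<^sup>2 / 4) = sqrt 2 * normal_density 0 (sqrt 2) x" for x
  proof -
    have "exp (- (x\<^sup>2 / 2)) * exp (x\<^sup>2 / 4) = exp (- (x\<^sup>2 / 4))"
      by (simp add: exp_add[symmetric])
    then show ?thesis
      by (simp add: normal_density_def real_sqrt_mult field_simps)
  qed
  have "(\<integral>\<^sup>+x. ennreal (exp (x\<^sup>2 / 4)) \<partial>std_gauss) =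
      (\<integral>\<^sup>+x. ennreal (std_normal_density x) * ennreal (exp (x\<^sup>2 / 4)) \<partial>lborel)"
    by (subst nn_integral_density) auto
  also have "\<dots> = (\<integral>\<^sup>+x. ennreal (sqrt 2) * ennreal (normal_density 0 (sqrt 2) x) \<partial>lborel)"
    by (simp add: ennreal_mult[symmetric] * normal_density_nonneg)
  also have "\<dots> = ennreal (sqrt 2) * (\<integral>\<^sup>+x. ennreal (normal_density 0 (sqrt 2) x) \<partial>lborel)"
    by (rule nn_integral_cmult) auto
  also have "(\<integral>\<^sup>+x. ennreal (normal_density 0 (sqrt 2) x) \<partial>lborel) = 1"
    by (subst nn_integral_eq_integral) (auto simp: normal_density_nonneg)
  finally show ?thesis by simp
qed

text \<open>Chernoff bound with parameter 1/4: each coordinate contributes the factor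
  \<open>sqrt 2\<close> from its exponential moment and \<open>exp (- 1)\<close> from the threshold
  4 per time slot. Their product is below 1.\<close>

lemma gauss_energy_tail:
  fixes n :: nat
  defines "M \<equiv> \<Pi>\<^sub>M t\<in>{1..n}. std_gauss"
  shows "emeasure M {y \<in> space M. 4 * real n < (\<Sum>t=1..n. (y t)\<^sup>2)} \<le> ennreal ((sqrt 2 * exp (- 1)) ^ n)"
proof -
  interpret product_prob_space "\<lambda>_. std_gauss" "{1..n}"
    by (intro product_prob_spaceI prob_space_std_gauss)
  let ?f = "\<lambda>y::nat \<Rightarrow> real. \<Prod>t=1..n. ennreal (exp ((y t)\<^sup>2 / 4))"
  have meas[measurable]: "?f \<in> borel_measurable M" unfolding M_def by measurable
  have "{y \<in> space M. 4 * real n < (\<Sum>t=1..n. (y t)\<^sup>2)} \<subseteq>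
      {y \<in> space M. 1 \<le> ennreal (exp (- real n)) * ?f y}"
  proof safe
    fix y assume "4 * real n < (\<Sum>t=1..n. (y t)\<^sup>2)"
    then have "exp 0 \<le> exp (- real n + (\<Sum>t=1..n. (y t)\<^sup>2 / 4))"
      by (subst exp_le_cancel_iff) (simp flip: sum_divide_distrib)
    also have "\<dots> = exp (- real n) * (\<Prod>t=1..n. exp ((y t)\<^sup>2 / 4))"
      by (subst exp_add) (simp add: exp_sum)
    finally have "ennreal 1 \<le> ennreal (exp (- real n) * (\<Prod>t=1..n. exp ((y t)\<^sup>2 / 4)))"
      by (intro ennreal_leI) simp
    then show "1 \<le> ennreal (exp (- real n)) * ?f y"
      by (simp add: ennreal_mult prod_nonneg prod_ennreal)
  qed
  then have "emeasure M {y \<in> space M. 4 * real n < (\<Sum>t=1..n. (y t)\<^sup>2)}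
      \<le> emeasure M {y \<in> space M. 1 \<le> ennreal (exp (- real n)) * ?f y}"
  proof (rule emeasure_mono)
    show "{y \<in> space M. 1 \<le> ennreal (exp (- real n)) * ?f y} \<in> sets M" by measurable
  qed
  also have "\<dots> \<le> ennreal (exp (- real n)) * (\<integral>\<^sup>+y. ?f y * indicator (space M) y \<partial>M)"
    by (rule nn_integral_Markov_inequality) (intro borel_measurable_times_ennreal meas, measurable)
  also have "(\<integral>\<^sup>+y. ?f y * indicator (space M) y \<partial>M) = (\<integral>\<^sup>+y. ?f y \<partial>M)"
    by (intro nn_integral_cong) simp
  also have "\<dots> = (\<Prod>t=1..n. \<integral>\<^sup>+x. ennreal (exp (x\<^sup>2 / 4)) \<partial>std_gauss)"
    unfolding M_def by (rule product_nn_integral_prod) auto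
  also have "\<dots> = ennreal (sqrt 2 ^ n)"
    unfolding nn_integral_std_gauss_exp_square by (simp add: ennreal_power)
  also have "ennreal (exp (- real n)) * ennreal (sqrt 2 ^ n) = ennreal ((sqrt 2 * exp (- 1)) ^ n)"
    by (simp add: power_mult_distrib mult.commute exp_of_nat_mult[symmetric] flip: ennreal_mult)
  finally show ?thesis .
qed

text \<open>The mean energy at one Rx is \<open>real n\<close>; the threshold of four times that
  already makes the tail decay geometrically.\<close>

definition large_noise :: "nat \<Rightarrow> nat \<Rightarrow> (nat \<Rightarrow> nat \<Rightarrow> real) set" where
  "large_noise K n = {z \<in> space (noise_measure K n). \<exists>k\<in>{1..K}. 4 * real n < (\<Sum>t=1..n. (z k t)\<^sup>2)}"

lemma large_noise_component_sets:
  "{y \<in> space (\<Pi>\<^sub>M t\<in>{1..n}. std_gauss). 4 * real n < (\<Sum>t=1..n. (y t)\<^sup>2)}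
    \<in> sets (\<Pi>\<^sub>M t\<in>{1..n}. std_gauss)"
  by measurable

lemma large_noise_sets_measure:
  shows "large_noise K n \<in> sets (noise_measure K n)"
    and "measure (noise_measure K n) (large_noise K n) \<le> real K * (sqrt 2 * exp (- 1)) ^ n"
proof -
  let ?I = "\<Pi>\<^sub>M t\<in>{1..n}. std_gauss"
  let ?A = "{y \<in> space ?I. 4 * real n < (\<Sum>t=1..n. (y t)\<^sup>2)}"
  define E where "E k = {z \<in> space (noise_measure K n). z k \<in> ?A}" for k
  interpret P: product_prob_space "\<lambda>_. ?I" "{1..K}"
    by (intro product_prob_spaceI prob_space_PiM prob_space_std_gauss)
  interpret prob_space "noise_measure K n" by (rule prob_space_noise_measure)
  have E: "E k \<in> sets (noise_measure K n)"
    "measure (noise_measure K n) (E k) \<le> (sqrt 2 * exp (- 1)) ^ n" if "k \<in> {1..K}" for k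
  proof -
    have "(\<lambda>z. z k) \<in> noise_measure K n \<rightarrow>\<^sub>M ?I"
      unfolding noise_measure_def using that by (rule measurable_component_singleton)
    from measurable_sets[OF this large_noise_component_sets]
    show "E k \<in> sets (noise_measure K n)"
      by (simp add: E_def vimage_def Int_def conj_commute)
    have "emeasure (noise_measure K n) (E k) = emeasure ?I ?A"
      unfolding E_def noise_measure_def
      by (rule P.emeasure_PiM_Collect_single[OF that large_noise_component_sets])
    also have "\<dots> \<le> ennreal ((sqrt 2 * exp (- 1)) ^ n)" by (rule gauss_energy_tail)
    finally show "measure (noise_measure K n) (E k) \<le> (sqrt 2 * exp (- 1)) ^ n"
      by (simp add: emeasure_eq_measure)
  qed
  have "z k \<in> space ?I" if "z \<in> space (noise_measure K n)" "k \<in> {1..K}" for z k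
    using that by (auto simp: noise_measure_def space_PiM)
  then have eq: "large_noise K n = (\<Union>k\<in>{1..K}. E k)"
    by (auto simp: large_noise_def E_def)
  show "large_noise K n \<in> sets (noise_measure K n)"
    unfolding eq using E(1) by auto
  have "measure (noise_measure K n) (large_noise K n) \<le> (\<Sum>k\<in>{1..K}. measure (noise_measure K n) (E k))"
    unfolding eq using E(1) by (intro finite_measure_subadditive_finite) auto
  also have "\<dots> \<le> (\<Sum>k\<in>{1..K}. (sqrt 2 * exp (- 1)) ^ n)" by (intro sum_mono E(2))
  finally show "measure (noise_measure K n) (large_noise K n) \<le> real K * (sqrt 2 * exp (- 1)) ^ n"
    by simp
qed

lemma large_noise_vanishes: "(\<lambda>n. real K * (sqrt 2 * exp (- 1)) ^ n) \<longlonglongrightarrow> 0"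
proof -
  have "sqrt 2 < 2" by (rule real_less_lsqrt) auto
  also have "2 \<le> exp (1::real)" using exp_ge_add_one_self[of 1] by simp
  finally have "sqrt 2 * exp (- 1) < 1" by (simp add: exp_minus field_simps)
  then show ?thesis by (intro tendsto_mult_right_zero LIMSEQ_realpow_zero) auto
qed

section \<open>Coding for a transmission schedule\<close>

text \<open>What Rx \<open>k\<close> can compute from its own output \<open>y\<close> and its inbox
  \<open>v\<close>. The index is shifted: the message of round \<open>Suc d\<close> carries the
  sender's iterate number \<open>d\<close>.\<close>

primrec local_iterate ::
  "nat \<Rightarrow> network \<Rightarrow> (nat \<Rightarrow> nat set) \<Rightarrow> nat \<Rightarrow> (nat \<Rightarrow> real) \<Rightarrow> inbox \<Rightarrow> nat \<Rightarrow> nat \<Rightarrow> real"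
where
  "local_iterate K N T k y v 0 = (\<lambda>t. if k \<in> T t then y t else 0)"
| "local_iterate K N T k y v (Suc d) = (\<lambda>t. if k \<in> T t
     then gain N k k * local_iterate K N T k y v d t
       + (\<Sum>j\<in>neighbours K N k \<inter> T t. gain N j k * v (Suc d, j) t)
     else 0)"

definition iterate ::
  "nat \<Rightarrow> network \<Rightarrow> (nat \<Rightarrow> nat set) \<Rightarrow> (nat \<Rightarrow> nat \<Rightarrow> real) \<Rightarrow> nat \<Rightarrow> nat \<Rightarrow> nat \<Rightarrow> real"
where
  "iterate K N T y d k t = (net_op K N (T t) ^^ d) (\<lambda>j. if j \<in> T t then y j t else 0) k"

lemma local_iterate_eq_iterate:
  assumes "\<And>r j. r \<in> {1..d} \<Longrightarrow> j \<in> neighbours K N k \<inter> T t \<Longrightarrow> v (r, j) t = iterate K N T y (r - 1) j t"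
  shows "local_iterate K N T k (y k) v d t = iterate K N T y d k t"
  using assms
proof (induction d)
  case (Suc d)
  have "(\<Sum>j\<in>neighbours K N k \<inter> T t. gain N j k * v (Suc d, j) t) =
      (\<Sum>j\<in>neighbours K N k \<inter> T t. gain N j k * iterate K N T y d j t)"
    using Suc.prems[of "Suc d"] by (intro sum.cong) auto
  moreover have "local_iterate K N T k (y k) v d t = iterate K N T y d k t"
    using Suc.prems by (intro Suc.IH) auto
  ultimately show ?case by (simp add: iterate_def net_op_def)
qed (simp add: iterate_def)

text \<open>Bounded-distance decoding. \<open>LEAST\<close> makes it a total function; when no
  codeword lies in the ball its value is arbitrary, which can only happen outside the good noise
  event.\<close>

definition ball_decoder ::
  "nat set \<Rightarrow> real \<Rightarrow> nat \<Rightarrow> (nat \<Rightarrow> nat \<Rightarrow> real) \<Rightarrow> (nat \<Rightarrow> real) \<Rightarrow> nat"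
where
  "ball_decoder S r M u x = (LEAST m. m \<in> {1..M} \<and> (\<Sum>t\<in>S. (x t - u m t)\<^sup>2) \<le> r)"

lemma measurable_ball_decoder:
  assumes "\<And>t. t \<in> S \<Longrightarrow> (\<lambda>w. x w t) \<in> borel_measurable Q"
  shows "(\<lambda>w. ball_decoder S r M u (x w)) \<in> Q \<rightarrow>\<^sub>M count_space UNIV"
proof -
  have [measurable]: "(\<lambda>w. \<Sum>t\<in>S. (x w t - u m t)\<^sup>2) \<in> borel_measurable Q" for m
    using assms by (intro borel_measurable_sum borel_measurable_power borel_measurable_diff) auto
  show ?thesis unfolding ball_decoder_def
    by (intro measurable_Least) measurable
qed

text \<open>Two codewords within squared distance \<open>r\<close> of the same point are within
  squared distance \<open>4 * r\<close> of each other, because the square of a difference is at most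
  twice the sum of the squares.\<close>

lemma ball_decoder_correct:
  assumes m: "m \<in> {1..M}" "(\<Sum>t\<in>S. (x t - u m t)\<^sup>2) \<le> r"
    and sep: "\<And>m'. m' \<in> {1..M} \<Longrightarrow> m' \<noteq> m \<Longrightarrow> 4 * r < (\<Sum>t\<in>S. (u m t - u m' t)\<^sup>2)"
  shows "ball_decoder S r M u x = m"
  unfolding ball_decoder_def
proof (rule Least_equality)
  fix m' assume m': "m' \<in> {1..M} \<and> (\<Sum>t\<in>S. (x t - u m' t)\<^sup>2) \<le> r"
  have "(\<Sum>t\<in>S. (u m t - u m' t)\<^sup>2) \<le> (\<Sum>t\<in>S. 2 * (x t - u m t)\<^sup>2 + 2 * (x t - u m' t)\<^sup>2)"
  proof (intro sum_mono)
    fix t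
    have "2 * (x t - u m t)\<^sup>2 + 2 * (x t - u m' t)\<^sup>2 - (u m t - u m' t)\<^sup>2
        = ((x t - u m t) + (x t - u m' t))\<^sup>2"
      by (simp add: power2_eq_square algebra_simps)
    then show "(u m t - u m' t)\<^sup>2 \<le> 2 * (x t - u m t)\<^sup>2 + 2 * (x t - u m' t)\<^sup>2"
      using zero_le_power2[of "(x t - u m t) + (x t - u m' t)"] by linarith
  qed
  also have "\<dots> = 2 * (\<Sum>t\<in>S. (x t - u m t)\<^sup>2) + 2 * (\<Sum>t\<in>S. (x t - u m' t)\<^sup>2)"
    by (simp add: sum.distrib sum_distrib_left)
  also have "\<dots> \<le> 4 * r" using m m' by linarith
  finally show "m \<le> m'" using sep[of m'] m' by force
qed (use m in auto)

lemma finite_set_activity_pmf: "finite (set_pmf (activity_pmf \<rho> \<rho>\<^sub>f K))"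
proof -
  have "set_pmf (activity_pmf \<rho> \<rho>\<^sub>f K) \<subseteq> {f. \<forall>x. (x \<in> {1..K} \<longrightarrow> f x \<in> UNIV) \<and> (x \<notin> {1..K} \<longrightarrow> f x = (False, False))}"
    using set_Pi_pmf_subset[of "{1..K}" "(False, False)" "\<lambda>_. cell_activity_pmf \<rho> \<rho>\<^sub>f"]
    by (auto simp: activity_pmf_def)
  moreover have "finite {f :: activity. \<forall>x. (x \<in> {1..K} \<longrightarrow> f x \<in> UNIV) \<and> (x \<notin> {1..K} \<longrightarrow> f x = (False, False))}"
    by (rule finite_set_of_finite_funs) auto
  ultimately show ?thesis by (rule finite_subset)
qed

text \<open>
  \<open>T s t\<close> is the set of Txs sending at time \<open>t\<close>, \<open>u s k\<close> the codebook of Tx \<open>k\<close> with \<open>M s k\<close>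
  codewords, \<open>C T\<close> the coefficients of the polynomial that inverts the channel operator on \<open>T\<close>, and
  \<open>G\<close> a bound for the resulting noise gain.
\<close>

locale scheduled_coding =
  fixes K :: nat and N :: network and n :: nat and T :: "activity \<Rightarrow> nat \<Rightarrow> nat set"
    and C :: "nat set \<Rightarrow> nat \<Rightarrow> real" and G :: real
    and M :: "activity \<Rightarrow> nat \<Rightarrow> nat" and u :: "activity \<Rightarrow> nat \<Rightarrow> nat \<Rightarrow> nat \<Rightarrow> real"
  assumes T_active: "T s t \<subseteq> active K s"
    and isolated: "k \<in> urllc K s \<Longrightarrow> k \<in> T s t \<Longrightarrow> neighbours K N k \<inter> T s t = {}"
begin

definition on_times :: "activity \<Rightarrow> nat \<Rightarrow> nat set" where
  "on_times s k = {t \<in> {1..n}. k \<in> T s t}"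

text \<open>On the good event the noise energy is at most \<open>4 * real n\<close> at each of the
  \<open>K\<close> Rxs, and the inversion amplifies the total by at most \<open>G\<close>.\<close>

definition radius :: real where
  "radius = 4 * G * real K * real n"

text \<open>By \<open>isolated\<close>, a URLLC Rx needs only a division by its direct gain. A
  cooperation message carries a whole iterate, one real per time slot, and is padded by zeros beyond
  the block, where the output has no measurable coordinates.\<close>

definition code :: scheme where
  "code = \<lparr>
     rounds = K * K,
     enc = (\<lambda>s k m t. if k \<in> T s t then u s k m t else 0),
     dec_urllc = (\<lambda>s k y. ball_decoder (on_times s k) radius (M s k) (u s k) (\<lambda>t. y t / gain N k k)),
     coop = (\<lambda>s d j k p t. if t \<in> {1..n} then local_iterate K N (T s) j (fst p) (snd p) (d - 1) t else 0),
     dec_embb = (\<lambda>s k p. ball_decoder (on_times s k) radius (M s k) (u s k)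
       (\<lambda>t. \<Sum>d<K * K. C (T s t) d * local_iterate K N (T s) k (fst p) (snd p) d t))\<rparr>"

lemma active_nbrs_T: "neighbours K N k \<inter> T s t \<subseteq> active_nbrs K N s k"
  using T_active by (auto simp: active_nbrs_def)

lemma measurable_local_iterate:
  assumes "t \<in> {1..n}"
  shows "d \<le> d' \<Longrightarrow> (\<lambda>p. local_iterate K N (T s) k (fst p) (snd p) d t)
    \<in> output_space n \<Otimes>\<^sub>M inbox_space K N s d' k \<rightarrow>\<^sub>M borel"
proof (induction d)
  case 0
  have "(\<lambda>p. fst p t) \<in> output_space n \<Otimes>\<^sub>M inbox_space K N s d' k \<rightarrow>\<^sub>M borel"
    using assms by (intro measurable_compose[OF measurable_fst measurable_component_singleton])
  then show ?case by simp
next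
  case (Suc d)
  have "(\<lambda>p. snd p (Suc d, j) t) \<in> output_space n \<Otimes>\<^sub>M inbox_space K N s d' k \<rightarrow>\<^sub>M borel"
    if j: "j \<in> neighbours K N k \<inter> T s t" for j
  proof -
    have "(Suc d, j) \<in> {1..d'} \<times> active_nbrs K N s k"
      using j active_nbrs_T Suc.prems by auto
    then have "(\<lambda>v. v (Suc d, j)) \<in> inbox_space K N s d' k \<rightarrow>\<^sub>M coop_msg_space"
      unfolding inbox_space_def by (rule measurable_component_singleton)
    moreover have "(\<lambda>m. m t) \<in> coop_msg_space \<rightarrow>\<^sub>M borel"
      by (rule measurable_component_singleton) simp
    ultimately show ?thesis
      by (rule measurable_compose[OF measurable_compose[OF measurable_snd]])
  qed
  moreover have "(\<lambda>p. local_iterate K N (T s) k (fst p) (snd p) d t)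
      \<in> output_space n \<Otimes>\<^sub>M inbox_space K N s d' k \<rightarrow>\<^sub>M borel"
    using Suc by simp
  ultimately show ?case
    by (auto intro!: borel_measurable_add borel_measurable_times borel_measurable_sum)
qed

lemma valid_code:
  assumes n: "1 \<le> n" and u: "\<And>s k m t. (u s k m t)\<^sup>2 \<le> P" and P: "0 \<le> P"
  shows "valid_scheme K N \<rho> \<rho>\<^sub>f P R\<^sub>U R\<^sub>e n code"
  unfolding valid_scheme_def
proof (intro ballI conjI)
  fix s
  show "1 / real n * (\<Sum>t=1..n. (enc code s k m t)\<^sup>2) \<le> P" for k m
  proof -
    have "(\<Sum>t=1..n. (enc code s k m t)\<^sup>2) \<le> (\<Sum>t=1..n. P)"
      using u P by (intro sum_mono) (auto simp: code_def)
    then show ?thesis using n by (simp add: field_simps)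
  qed
  show "dec_urllc code s k \<in> output_space n \<rightarrow>\<^sub>M count_space UNIV" for k
    unfolding code_def scheme.simps
    by (intro measurable_ball_decoder) (auto simp: on_times_def)
  show "coop code s d j k \<in> output_space n \<Otimes>\<^sub>M inbox_space K N s (d - 1) j \<rightarrow>\<^sub>M coop_msg_space"
    for d j k
    unfolding code_def scheme.simps
  proof (rule measurable_PiM_single')
    show "(\<lambda>p. if t \<in> {1..n} then local_iterate K N (T s) j (fst p) (snd p) (d - 1) t else 0)
        \<in> output_space n \<Otimes>\<^sub>M inbox_space K N s (d - 1) j \<rightarrow>\<^sub>M borel" for t
      using measurable_local_iterate[of t "d - 1" "d - 1"] by (cases "t \<in> {1..n}") auto
  qed auto
  show "dec_embb code s k \<in> output_space n \<Otimes>\<^sub>M inbox_space K N s (rounds code) k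
      \<rightarrow>\<^sub>M count_space UNIV" for k
    unfolding code_def scheme.simps
    by (intro measurable_ball_decoder borel_measurable_sum borel_measurable_times
        borel_measurable_const measurable_local_iterate) (auto simp: on_times_def)
qed

text \<open>Induction on rounds: after \<open>d\<close> rounds the sender's inbox holds all earlier
  iterates of its sending neighbours, which is exactly what it needs to form its own iterate
  \<open>d\<close>.\<close>

lemma received_eq_iterate:
  "r \<in> {1..d} \<Longrightarrow> j \<in> active_nbrs K N s k \<Longrightarrow> t \<in> {1..n} \<Longrightarrow>
    received K N code s y d k (r, j) t = iterate K N (T s) y (r - 1) j t"
proof (induction d arbitrary: r j k)
  case (Suc d)
  have "local_iterate K N (T s) j (y j) (received K N code s y d j) d t = iterate K N (T s) y d j t"
    using Suc.IH active_nbrs_T Suc.prems(3) by (intro local_iterate_eq_iterate) blast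
  then show ?case
    using Suc by (auto simp: code_def)
qed auto

text \<open>A deterministic statement: bounded noise energy rules out errors for every choice of
  messages. At each time both kinds of Rx estimate the input with squared error at most
  \<open>G\<close> times the noise energy of all Rxs at that time; summed over the block this stays
  within \<open>radius\<close>.\<close>

lemma no_error:
  assumes gain: "\<And>k. k \<in> {1..K} \<Longrightarrow> gain N k k \<noteq> 0 \<and> 1 / (gain N k k)\<^sup>2 \<le> G"
    and zf: "\<And>T x z k. T \<subseteq> {1..K} \<Longrightarrow> k \<in> T \<Longrightarrow> \<forall>j. j \<notin> T \<longrightarrow> x j = 0 \<Longrightarrow> \<forall>j. j \<notin> T \<longrightarrow> z j = 0 \<Longrightarrow>
      ((\<Sum>d<K * K. C T d * (net_op K N T ^^ d) (\<lambda>j. net_op K N T x j + z j) k) - x k)\<^sup>2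
        \<le> G * (\<Sum>j\<in>{1..K}. (z j)\<^sup>2)"
    and G: "0 \<le> G"
    and sep: "\<And>k m m'. k \<in> active K s \<Longrightarrow> m \<in> {1..M s k} \<Longrightarrow> m' \<in> {1..M s k} \<Longrightarrow> m' \<noteq> m \<Longrightarrow>
      4 * radius < (\<Sum>t\<in>on_times s k. (u s k m t - u s k m' t)\<^sup>2)"
    and m: "\<And>k. k \<in> active K s \<Longrightarrow> m k \<in> {1..M s k}"
    and z: "\<And>k. k \<in> {1..K} \<Longrightarrow> (\<Sum>t=1..n. (z k t)\<^sup>2) \<le> 4 * real n"
  shows "\<not> decoding_error K N n code s m z"
proof -
  define y where "y = channel_output K N n code s m z"
  define x where "x t j = (if j \<in> T s t then u s j (m j) t else 0)" for t j
  define z' where "z' t j = (if j \<in> T s t then z j t else 0)" for t j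
  have TK: "T s t \<subseteq> {1..K}" for t using T_active by (force simp: active_def)
  have fin: "finite (neighbours K N k)" for k by (simp add: neighbours_def)
  have inp: "channel_input K code s m j t = x t j" for j t
    using T_active by (auto simp: channel_input_def code_def x_def)
  have out: "y k t = net_op K N (T s t) (x t) k + z' t k" if "t \<in> {1..n}" "k \<in> T s t" for k t
  proof -
    have "(\<Sum>j\<in>neighbours K N k. gain N j k * x t j) =
        (\<Sum>j\<in>neighbours K N k \<inter> T s t. gain N j k * x t j)"
      using fin by (intro sum.mono_neutral_right) (auto simp: x_def)
    then show ?thesis
      using that by (simp add: y_def channel_output_def inp net_op_def z'_def)
  qed
  have energy: "(\<Sum>t\<in>on_times s k. G * (\<Sum>j\<in>{1..K}. (z j t)\<^sup>2)) \<le> radius" for k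
  proof -
    have "(\<Sum>t\<in>on_times s k. G * (\<Sum>j\<in>{1..K}. (z j t)\<^sup>2))
        \<le> (\<Sum>t=1..n. G * (\<Sum>j\<in>{1..K}. (z j t)\<^sup>2))"
      using G by (intro sum_mono2) (auto simp: on_times_def intro!: mult_nonneg_nonneg sum_nonneg)
    also have "\<dots> = G * (\<Sum>j\<in>{1..K}. \<Sum>t=1..n. (z j t)\<^sup>2)"
      by (subst sum.swap) (simp add: sum_distrib_left)
    also have "\<dots> \<le> G * (\<Sum>j\<in>{1..K}. 4 * real n)"
      using G z by (intro mult_left_mono sum_mono) auto
    finally show ?thesis by (simp add: radius_def mult_ac)
  qed
  have dec: "ball_decoder (on_times s k) radius (M s k) (u s k) e = m k"
    if k: "k \<in> active K s" and
      e: "\<And>t. t \<in> on_times s k \<Longrightarrow> (e t - x t k)\<^sup>2 \<le> G * (\<Sum>j\<in>{1..K}. (z j t)\<^sup>2)" for k e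
  proof (rule ball_decoder_correct)
    show "m k \<in> {1..M s k}" using m k by blast
    have "(\<Sum>t\<in>on_times s k. (e t - u s k (m k) t)\<^sup>2) = (\<Sum>t\<in>on_times s k. (e t - x t k)\<^sup>2)"
      by (intro sum.cong) (auto simp: on_times_def x_def)
    also have "\<dots> \<le> (\<Sum>t\<in>on_times s k. G * (\<Sum>j\<in>{1..K}. (z j t)\<^sup>2))"
      by (intro sum_mono e)
    finally show "(\<Sum>t\<in>on_times s k. (e t - u s k (m k) t)\<^sup>2) \<le> radius"
      using energy[of k] by linarith
  qed (use sep m k in auto)
  have "dec_urllc code s k (y k) = m k" if k: "k \<in> urllc K s" for k
  proof -
    have k': "k \<in> active K s" "k \<in> {1..K}" using k by (auto simp: urllc_def active_def)
    have "(y k t / gain N k k - x t k)\<^sup>2 \<le> G * (\<Sum>j\<in>{1..K}. (z j t)\<^sup>2)" if "t \<in> on_times s k" for t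
    proof -
      have t: "t \<in> {1..n}" "k \<in> T s t" using that by (auto simp: on_times_def)
      \<comment> \<open>While a URLLC Tx sends, none of its neighbours does, so the interference sum
        is empty.\<close>
      have "y k t = gain N k k * x t k + z k t"
        using out[OF t] isolated[OF k t(2)] t by (simp add: net_op_def z'_def)
      then have "(y k t / gain N k k - x t k)\<^sup>2 = 1 / (gain N k k)\<^sup>2 * (z k t)\<^sup>2"
        using gain[OF k'(2)] by (simp add: field_simps power2_eq_square)
      also have "\<dots> \<le> G * (\<Sum>j\<in>{1..K}. (z j t)\<^sup>2)"
        using gain[OF k'(2)] G k'(2)
        by (intro mult_mono member_le_sum[where f = "\<lambda>j. (z j t)\<^sup>2"]) auto
      finally show ?thesis .
    qed
    from dec[OF k'(1) this] show ?thesis by (simp add: code_def)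
  qed
  moreover have "dec_embb code s k (y k, received K N code s y (rounds code) k) = m k"
    if k: "k \<in> embb K s" for k
  proof -
    have k': "k \<in> active K s" using k by (auto simp: embb_def)
    let ?v = "received K N code s y (K * K) k"
    have "((\<Sum>d<K * K. C (T s t) d * local_iterate K N (T s) k (y k) ?v d t) - x t k)\<^sup>2
        \<le> G * (\<Sum>j\<in>{1..K}. (z j t)\<^sup>2)" if "t \<in> on_times s k" for t
    proof -
      have t: "t \<in> {1..n}" "k \<in> T s t" using that by (auto simp: on_times_def)
      \<comment> \<open>Discarding the outputs of silent cells leaves the operator on the senders
        plus noise supported on the senders, the form required by \<open>zf\<close>.\<close>
      have "(\<lambda>j. if j \<in> T s t then y j t else 0) = (\<lambda>j. net_op K N (T s t) (x t) j + z' t j)"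
        using out[OF t(1)] by (auto simp: z'_def net_op_def)
      then have it: "iterate K N (T s) y d k t =
          (net_op K N (T s t) ^^ d) (\<lambda>j. net_op K N (T s t) (x t) j + z' t j) k" for d
        by (simp add: iterate_def)
      have "local_iterate K N (T s) k (y k) ?v d t = iterate K N (T s) y d k t" if "d < K * K" for d
        using that t(1) active_nbrs_T
        by (intro local_iterate_eq_iterate received_eq_iterate) auto
      then have "(\<Sum>d<K * K. C (T s t) d * local_iterate K N (T s) k (y k) ?v d t) =
          (\<Sum>d<K * K. C (T s t) d *
            (net_op K N (T s t) ^^ d) (\<lambda>j. net_op K N (T s t) (x t) j + z' t j) k)"
        unfolding it[symmetric] by (intro sum.cong) auto
      then have "((\<Sum>d<K * K. C (T s t) d * local_iterate K N (T s) k (y k) ?v d t) - x t k)\<^sup>2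
          \<le> G * (\<Sum>j\<in>{1..K}. (z' t j)\<^sup>2)"
        using zf[OF TK t(2), of "x t" "z' t"] by (simp add: x_def z'_def)
      also have "\<dots> \<le> G * (\<Sum>j\<in>{1..K}. (z j t)\<^sup>2)"
        using G by (intro mult_left_mono sum_mono) (auto simp: z'_def)
      finally show ?thesis .
    qed
    from dec[OF k' this] show ?thesis by (simp add: code_def)
  qed
  ultimately show ?thesis unfolding decoding_error_def y_def Let_def by blast
qed

end

section \<open>Error probability and codebooks of bounded power\<close>

lemma error_prob_le:
  assumes no_error: "\<And>s m z. s \<in> set_pmf (activity_pmf \<rho> \<rho>\<^sub>f K) \<Longrightarrow>
      (\<And>k. k \<in> active K s \<Longrightarrow> m k \<in> {1..num_messages n (tx_rate K R\<^sub>U R\<^sub>e s k)}) \<Longrightarrow>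
      (\<And>k. k \<in> {1..K} \<Longrightarrow> (\<Sum>t=1..n. (z k t)\<^sup>2) \<le> 4 * real n) \<Longrightarrow> \<not> decoding_error K N n c s m z"
    and pos: "\<And>s k. s \<in> set_pmf (activity_pmf \<rho> \<rho>\<^sub>f K) \<Longrightarrow> k \<in> active K s \<Longrightarrow>
      1 \<le> num_messages n (tx_rate K R\<^sub>U R\<^sub>e s k)"
  shows "error_prob K N \<rho> \<rho>\<^sub>f R\<^sub>U R\<^sub>e n c \<le> real K * (sqrt 2 * exp (- 1)) ^ n"
proof -
  interpret Z: prob_space "noise_measure K n" by (rule prob_space_noise_measure)
  have "measure Q {(m, z) \<in> space Q. decoding_error K N n c s m z} \<le> real K * (sqrt 2 * exp (- 1)) ^ n"
    if s: "s \<in> set_pmf (activity_pmf \<rho> \<rho>\<^sub>f K)"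
      and Q: "Q = measure_pmf (message_pmf K R\<^sub>U R\<^sub>e n s) \<Otimes>\<^sub>M noise_measure K n" for s Q
  proof -
    let ?\<mu> = "message_pmf K R\<^sub>U R\<^sub>e n s"
    interpret Q: prob_space Q unfolding Q
      by (intro prob_space_pair measure_pmf.prob_space_axioms Z.prob_space_axioms)
    have fin: "finite (active K s)" by (simp add: active_def)
    have supp: "m k \<in> {1..num_messages n (tx_rate K R\<^sub>U R\<^sub>e s k)}"
      if "m \<in> set_pmf ?\<mu>" "k \<in> active K s" for m k
      using that pos[OF s that(2)] fin unfolding message_pmf_def set_Pi_pmf[OF fin]
      by (auto simp: PiE_dflt_def)
    \<comment> \<open>All errors lie in two sets: excessive noise, and messages outside the support,
      which belong to the product space but have probability zero.\<close>
    let ?A = "UNIV \<times> large_noise K n" and ?B = "(- set_pmf ?\<mu>) \<times> space (noise_measure K n)"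
    have sets: "?A \<in> sets Q" "?B \<in> sets Q"
      unfolding Q by (intro pair_measureI large_noise_sets_measure sets.top; simp)+
    have "{(m, z) \<in> space Q. decoding_error K N n c s m z} \<subseteq> ?A \<union> ?B"
    proof
      fix p assume "p \<in> {(m, z) \<in> space Q. decoding_error K N n c s m z}"
      then obtain m z where p: "p = (m, z)" "decoding_error K N n c s m z"
        and z: "z \<in> space (noise_measure K n)"
        by (auto simp: Q space_pair_measure)
      show "p \<in> ?A \<union> ?B"
      proof (cases "m \<in> set_pmf ?\<mu>")
        case True
        then have "\<not> (\<forall>k\<in>{1..K}. (\<Sum>t=1..n. (z k t)\<^sup>2) \<le> 4 * real n)"
          using no_error[OF s, of m z] supp p(2) by blast
        then show ?thesis using z p(1) by (auto simp: large_noise_def not_le)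
      qed (use z p(1) in auto)
    qed
    then have "measure Q {(m, z) \<in> space Q. decoding_error K N n c s m z} \<le> measure Q (?A \<union> ?B)"
      using sets by (intro Q.finite_measure_mono) auto
    also have "\<dots> \<le> measure Q ?A + measure Q ?B"
      using sets by (intro measure_Un_le)
    also have "measure Q ?A = measure (noise_measure K n) (large_noise K n)"
      unfolding Q measure_def
      by (subst Z.emeasure_pair_measure_Times) (auto intro: large_noise_sets_measure)
    also have "measure Q ?B = 0"
    proof -
      have "measure_pmf.prob ?\<mu> (- set_pmf ?\<mu>) = 0" by (subst measure_pmf_zero_iff) auto
      then show ?thesis unfolding Q measure_def[of "measure_pmf ?\<mu> \<Otimes>\<^sub>M _"]
        by (subst Z.emeasure_pair_measure_Times) (auto simp: measure_pmf.emeasure_eq_measure)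
    qed
    finally show ?thesis using large_noise_sets_measure(2)[of K n] by simp
  qed
  then show ?thesis unfolding error_prob_def Let_def
    by (intro measure_pmf.integral_le_const integrable_measure_pmf_finite finite_set_activity_pmf)
      (simp add: AE_measure_pmf_iff)
qed

text \<open>In the rate loss \<open>D + 4\<close>, the term \<open>D\<close> pays for the factor
  \<open>2 ^ r\<close> in the ball volume and 2 for the factor \<open>4 ^ card S\<close>. The other
  2 absorbs, for long blocks, the rounding of \<open>r\<close> and the up to three lost time slots,
  which cost \<open>3 * l\<close>.\<close>

lemma bounded_power_code:
  fixes S :: "nat set" and l D :: real
  assumes S: "finite S" "card S \<le> n" "w * real n - 3 \<le> real (card S)"
    and w: "0 \<le> w" and P: "0 < P" and D: "0 \<le> D" and l: "l = 1/2 * log 2 P"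
    and M: "M = num_messages n (max 0 (w * l - (D + 4)))"
  shows "\<exists>u :: nat \<Rightarrow> nat \<Rightarrow> real. (\<forall>m t. (u m t)\<^sup>2 \<le> P) \<and>
    (1 \<le> n \<longrightarrow> 3 * l \<le> real n \<longrightarrow> (\<forall>m\<in>{1..M}. \<forall>m'\<in>{1..M}. m' \<noteq> m \<longrightarrow>
      D * real n < (\<Sum>t\<in>S. (u m t - u m' t)\<^sup>2)))"
\<comment> \<open>If the rate is zero there is at most one message, and for short blocks no
  separation is claimed; the zero codebook then works.\<close>
proof (cases "1 \<le> n \<and> 3 * l \<le> real n \<and> D + 4 < w * l")
  case False
  have "M \<le> 1" if "\<not> D + 4 < w * l"
    using that by (simp add: M num_messages_def)
  with False P show ?thesis by (intro exI[of _ "\<lambda>_ _. 0"]) fastforce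
next
  case True
  then have wl: "D + 4 < w * l" and n: "1 \<le> n" "3 * l \<le> real n" by auto
  have "0 < w * l" using wl D by linarith
  then have l0: "0 < l" using w by (simp add: zero_less_mult_iff)
  define r where "r = nat \<lceil>D * real n\<rceil>"
  \<comment> \<open>The letters are the integers from 0 to the integer part of
    \<open>sqrt P\<close>. Each obeys the power constraint by itself, and there are at least
    \<open>2 powr l\<close> of them.\<close>
  define q where "q = nat \<lfloor>sqrt P\<rfloor> + 1"
  have r: "D * real n \<le> real r" "real r \<le> D * real n + 1"
    using D by (auto simp: r_def)
  have "2 powr l = (2 powr log 2 P) powr (1/2)"
    by (simp add: l powr_powr)
  also have "\<dots> = sqrt P" using P by (simp add: powr_half_sqrt)
  finally have "2 powr l = sqrt P" .
  then have q: "2 powr l \<le> real q"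
    using P by (simp add: q_def) linarith
  have "real M \<le> 2 powr (real n * (w * l - (D + 4)))"
    using wl by (simp add: M num_messages_def)
  then have "real M * (2 ^ r * 4 ^ card S) \<le> 2 powr (real n * (w * l - (D + 4))) * (2 powr (D * real n + 1) * 2 powr (2 * real n))"
  proof (intro mult_mono)
    show "(2::real) ^ r \<le> 2 powr (D * real n + 1)"
      using r(2) by (simp add: powr_realpow[symmetric])
    have "(4::real) ^ card S = 2 powr (2 * real (card S))"
      using powr_realpow[of 2 "2 * card S"] by (simp add: power_mult)
    then show "(4::real) ^ card S \<le> 2 powr (2 * real n)" using S(2) by simp
  qed auto
  also have "\<dots> = 2 powr (w * l * real n - real n - real n + 1)"
    by (simp add: powr_add[symmetric] algebra_simps)
  also have "\<dots> \<le> 2 powr (l * real (card S))"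
  proof -
    have "l * (w * real n - 3) \<le> l * real (card S)"
      using l0 S(3) by (intro mult_left_mono) auto
    moreover have "l * (w * real n - 3) = w * l * real n - 3 * l" by (simp add: algebra_simps)
    ultimately show ?thesis using n by simp
  qed
  also have "\<dots> = (2 powr l) ^ card S" by (simp add: powr_powr[symmetric] powr_realpow)
  also have "\<dots> \<le> real q ^ card S" using q by (intro power_mono) auto
  finally have "real M * (2 ^ r * 4 ^ card S) \<le> real q ^ card S" .
  from grid_code[OF S(1) this] obtain v :: "nat \<Rightarrow> nat \<Rightarrow> nat" where
    v: "\<And>m. m \<in> {1..M} \<Longrightarrow> v m \<in> S \<rightarrow>\<^sub>E {..<q}"
    "\<And>m m'. m \<in> {1..M} \<Longrightarrow> m' \<in> {1..M} \<Longrightarrow> m \<noteq> m' \<Longrightarrow>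
        real r < (\<Sum>t\<in>S. (real (v m t) - real (v m' t))\<^sup>2)"
    by blast
  define u where "u m t = (if m \<in> {1..M} \<and> t \<in> S then real (v m t) else 0)" for m t
  have "(u m t)\<^sup>2 \<le> P" for m t
  proof (cases "m \<in> {1..M} \<and> t \<in> S")
    case True
    then have "v m t < q" using v(1)[of m] by auto
    then have "real (v m t) \<le> real (nat \<lfloor>sqrt P\<rfloor>)" by (simp add: q_def)
    also have "\<dots> \<le> sqrt P" using P by (intro of_nat_floor) simp
    finally have "real (v m t) \<le> sqrt P" .
    then have "(real (v m t))\<^sup>2 \<le> (sqrt P)\<^sup>2" by (intro power_mono) auto
    then show ?thesis using True P by (simp add: u_def)
  qed (use P in \<open>auto simp: u_def\<close>)
  moreover have "D * real n < (\<Sum>t\<in>S. (u m t - u m' t)\<^sup>2)"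
    if "m \<in> {1..M}" "m' \<in> {1..M}" "m' \<noteq> m" for m m'
    using v(2)[of m m'] that r(1) by (simp add: u_def)
  ultimately show ?thesis by blast
qed

text \<open>\<open>w s k\<close> is the share of time in which Tx \<open>k\<close> sends. The gap
  \<open>\<beta>\<close> is chosen before the power and the activity. Truncating the rate at zero
  keeps the claim true for small powers, where only one message remains.\<close>

lemma scheduled_rates_achievable:
  fixes w :: "activity \<Rightarrow> nat \<Rightarrow> real" and T :: "nat \<Rightarrow> activity \<Rightarrow> nat \<Rightarrow> nat set"
  assumes gen: "generic_gains K N"
    and T: "\<And>n s t. T n s t \<subseteq> active K s"
    and iso: "\<And>n k s t. k \<in> urllc K s \<Longrightarrow> k \<in> T n s t \<Longrightarrow> neighbours K N k \<inter> T n s t = {}"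
    and w: "\<And>s k. 0 \<le> w s k"
    and card: "\<And>n s k. k \<in> active K s \<Longrightarrow> w s k * real n - 3 \<le> real (card {t \<in> {1..n}. k \<in> T n s t})"
  shows "\<exists>\<beta>\<ge>0. \<forall>P>0. \<forall>R\<^sub>U R\<^sub>e.
    (\<forall>s. \<forall>k\<in>active K s. tx_rate K R\<^sub>U R\<^sub>e s k = max 0 (w s k * (1/2 * log 2 P) - \<beta>)) \<longrightarrow>
    (\<exists>c. (\<forall>n\<ge>1. valid_scheme K N \<rho> \<rho>\<^sub>f P R\<^sub>U R\<^sub>e n (c n)) \<and>
      (\<lambda>n. error_prob K N \<rho> \<rho>\<^sub>f R\<^sub>U R\<^sub>e n (c n)) \<longlonglongrightarrow> 0)"
proof -
  from zero_forcing[OF gen] obtain C G0 where G0: "0 \<le> G0" and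
    zf: "\<forall>T\<subseteq>{1..K}. \<forall>x z. \<forall>k\<in>T.
      (\<forall>j. j \<notin> T \<longrightarrow> x j = 0) \<longrightarrow> (\<forall>j. j \<notin> T \<longrightarrow> z j = 0) \<longrightarrow>
      ((\<Sum>d<K * K. C T d * (net_op K N T ^^ d) (\<lambda>j. net_op K N T x j + z j) k) - x k)\<^sup>2
        \<le> G0 * (\<Sum>j\<in>{1..K}. (z j)\<^sup>2)"
    by (elim exE conjE) (rule that; assumption)
  \<comment> \<open>One constant for both decoders: the noise gain of the inversion plus that of
    dividing by any direct gain.\<close>
  define G where "G = G0 + (\<Sum>k\<in>{1..K}. 1 / (gain N k k)\<^sup>2)"
  have G: "0 \<le> G" "G0 \<le> G" using G0 by (auto simp: G_def intro!: add_nonneg_nonneg sum_nonneg)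
  have gain: "gain N k k \<noteq> 0 \<and> 1 / (gain N k k)\<^sup>2 \<le> G" if k: "k \<in> {1..K}" for k
  proof
    \<comment> \<open>Genericity for the one-element set \<open>{k}\<close>, in which
      \<open>k\<close> has no neighbour.\<close>
    show "gain N k k \<noteq> 0"
    proof
      assume "gain N k k = 0"
      moreover have "neighbours K N k \<inter> {k} = {}" by (simp add: neighbours_eq_unit_distance)
      ultimately show False
        using gen[unfolded generic_gains_def, rule_format, of "{k}" "\<lambda>_. 1" k] k by auto
    qed
    have "1 / (gain N k k)\<^sup>2 \<le> (\<Sum>k\<in>{1..K}. 1 / (gain N k k)\<^sup>2)"
      using k by (intro member_le_sum) auto
    then show "1 / (gain N k k)\<^sup>2 \<le> G" using G0 by (simp add: G_def)
  qed
  have zf': "((\<Sum>d<K * K. C T d * (net_op K N T ^^ d) (\<lambda>j. net_op K N T x j + z j) k) - x k)\<^sup>2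
        \<le> G * (\<Sum>j\<in>{1..K}. (z j)\<^sup>2)"
    if "T \<subseteq> {1..K}" "k \<in> T" "\<forall>j. j \<notin> T \<longrightarrow> x j = 0" "\<forall>j. j \<notin> T \<longrightarrow> z j = 0" for T x z k
  proof -
    have "((\<Sum>d<K * K. C T d * (net_op K N T ^^ d) (\<lambda>j. net_op K N T x j + z j) k) - x k)\<^sup>2
        \<le> G0 * (\<Sum>j\<in>{1..K}. (z j)\<^sup>2)"
      using zf[rule_format, of T k x z] that by simp
    also have "\<dots> \<le> G * (\<Sum>j\<in>{1..K}. (z j)\<^sup>2)"
      using G(2) by (intro mult_right_mono sum_nonneg) auto
    finally show ?thesis .
  qed
  \<comment> \<open>Chosen so that \<open>D * real n\<close> is four times the decoding radius, the
    separation that \<open>ball_decoder_correct\<close> demands.\<close>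
  define D where "D = 16 * G * real K"
  have D: "0 \<le> D" using G by (simp add: D_def)
  have "\<exists>c. (\<forall>n\<ge>1. valid_scheme K N \<rho> \<rho>\<^sub>f P R\<^sub>U R\<^sub>e n (c n)) \<and>
      (\<lambda>n. error_prob K N \<rho> \<rho>\<^sub>f R\<^sub>U R\<^sub>e n (c n)) \<longlonglongrightarrow> 0"
    if P: "0 < P" and R: "\<forall>s. \<forall>k\<in>active K s.
        tx_rate K R\<^sub>U R\<^sub>e s k = max 0 (w s k * (1/2 * log 2 P) - (D + 4))" for P R\<^sub>U R\<^sub>e
  proof -
    define l where "l = 1/2 * log 2 P"
    define M where "M n s k = num_messages n (tx_rate K R\<^sub>U R\<^sub>e s k)" for n s k
    define S where "S n s k = {t \<in> {1..n}. k \<in> T n s t}" for n s k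
    define good where "good n s k v \<longleftrightarrow> (\<forall>m t. (v m t)\<^sup>2 \<le> P) \<and>
      (k \<in> active K s \<longrightarrow> 1 \<le> n \<longrightarrow> 3 * l \<le> real n \<longrightarrow>
        (\<forall>m\<in>{1..M n s k}. \<forall>m'\<in>{1..M n s k}. m' \<noteq> m \<longrightarrow>
          D * real n < (\<Sum>t\<in>S n s k. (v m t - v m' t)\<^sup>2)))" for n s k and v :: "nat \<Rightarrow> nat \<Rightarrow> real"
    have ex: "\<exists>v. good n s k v" for n s k
    proof (cases "k \<in> active K s")
      case True
      have fin: "finite (S n s k)" by (simp add: S_def)
      have "card (S n s k) \<le> card {1..n}" by (intro card_mono) (auto simp: S_def)
      then have le: "card (S n s k) \<le> n" by simp
      have ge: "w s k * real n - 3 \<le> real (card (S n s k))"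
        unfolding S_def using True by (rule card)
      have M: "M n s k = num_messages n (max 0 (w s k * l - (D + 4)))"
        using R True by (simp add: M_def l_def)
      show ?thesis
        using bounded_power_code[OF fin le ge w P D l_def M] unfolding good_def by blast
    next
      case False
      then show ?thesis using P by (intro exI[of _ "\<lambda>_ _. 0"]) (simp add: good_def)
    qed
    define u where "u n s k = (SOME v. good n s k v)" for n s k
    have good: "good n s k (u n s k)" for n s k unfolding u_def by (rule someI_ex[OF ex])
    define c where "c n = scheduled_coding.code K N n (T n) C G (M n) (u n)" for n
    have sc: "scheduled_coding K N (T n)" for n
      by unfold_locales (use T iso in auto)
    have "valid_scheme K N \<rho> \<rho>\<^sub>f P R\<^sub>U R\<^sub>e n (c n)" if "1 \<le> n" for n
      unfolding c_def using that good P
      by (intro scheduled_coding.valid_code[OF sc]) (auto simp: good_def)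
    moreover have "(\<lambda>n. error_prob K N \<rho> \<rho>\<^sub>f R\<^sub>U R\<^sub>e n (c n)) \<longlonglongrightarrow> 0"
    proof (rule tendsto_sandwich[OF _ _ tendsto_const large_noise_vanishes[of K]])
      show "\<forall>\<^sub>F n in sequentially. 0 \<le> error_prob K N \<rho> \<rho>\<^sub>f R\<^sub>U R\<^sub>e n (c n)"
        by (auto simp: error_prob_def Let_def intro!: always_eventually Bochner_Integration.integral_nonneg)
      \<comment> \<open>Codewords are separated only once the block length exceeds
        \<open>3 * l\<close>; the limit ignores the finitely many shorter blocks.\<close>
      obtain n0 where n0: "3 * l \<le> real n0" using real_arch_simple by blast
      have "error_prob K N \<rho> \<rho>\<^sub>f R\<^sub>U R\<^sub>e n (c n) \<le> real K * (sqrt 2 * exp (- 1)) ^ n"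
        if n: "max 1 n0 \<le> n" for n
      proof (rule error_prob_le)
        fix s assume s: "s \<in> set_pmf (activity_pmf \<rho> \<rho>\<^sub>f K)"
        show "1 \<le> num_messages n (tx_rate K R\<^sub>U R\<^sub>e s k)" if "k \<in> active K s" for k
        proof -
          have "2 powr 0 \<le> 2 powr (real n * tx_rate K R\<^sub>U R\<^sub>e s k)"
            using R that by (intro powr_mono) auto
          then show ?thesis by (simp add: num_messages_def le_nat_iff)
        qed
        fix m z
        assume m: "\<And>k. k \<in> active K s \<Longrightarrow> m k \<in> {1..num_messages n (tx_rate K R\<^sub>U R\<^sub>e s k)}"
          and z: "\<And>k. k \<in> {1..K} \<Longrightarrow> (\<Sum>t=1..n. (z k t)\<^sup>2) \<le> 4 * real n"
        have "4 * scheduled_coding.radius K n G = D * real n"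
          by (simp add: scheduled_coding.radius_def[OF sc] D_def)
        moreover have "scheduled_coding.on_times n (T n) s k = S n s k" for k
          by (simp add: scheduled_coding.on_times_def[OF sc] S_def)
        moreover have "3 * l \<le> real n" "1 \<le> n" using n n0 by auto
        ultimately show "\<not> decoding_error K N n (c n) s m z"
          unfolding c_def using good[of n s] m z
          by (intro scheduled_coding.no_error[OF sc gain zf' G(1)]) (auto simp: good_def M_def)
      qed
      then show "\<forall>\<^sub>F n in sequentially. error_prob K N \<rho> \<rho>\<^sub>f R\<^sub>U R\<^sub>e n (c n)
          \<le> real K * (sqrt 2 * exp (- 1)) ^ n"
        unfolding eventually_sequentially by blast
    qed
    ultimately show ?thesis by blast
  qed
  then show ?thesis using D by (intro exI[of _ "D + 4"]) auto
qed

section \<open>The three-colour schedule\<close>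

definition colour :: "network \<Rightarrow> nat \<Rightarrow> nat" where
  "colour N k = nat ((fst (coord N k) + snd (coord N k)) mod 3)"

lemma colour_less: "colour N k < 3"
  by (simp add: colour_def nat_less_iff)

lemma int_colour: "int (colour N k) = (fst (coord N k) + snd (coord N k)) mod 3"
  by (simp add: colour_def)

text \<open>A step to an adjacent cell changes the coordinate sum by 1 or 2 up to sign, never by a
  multiple of 3. Grouped by the residue of this change, the six steps form two triples.\<close>

lemma colour_neighbour:
  assumes "j \<in> neighbours K N k"
  shows "colour N j \<noteq> colour N k"
    and "(colour N j = (colour N k + 2) mod 3 \<longrightarrow> coord N k - coord N j \<in> {(1, 0), (0, 1), (-1, -1)}) \<and>
      (colour N j = (colour N k + 1) mod 3 \<longrightarrow> coord N k - coord N j \<in> {(-1, 0), (0, -1), (1, 1)})"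
proof -
  obtain a b where k: "coord N k = (a, b)" by (cases "coord N k")
  obtain c d where j: "coord N j = (c, d)" by (cases "coord N j")
  obtain p q where pq: "a - c = p" "b - d = q" by blast
  have *: "(p, q) \<in> {(1,0), (-1,0), (0,1), (0,-1), (1,1), (-1,-1)}"
    using assms by (simp add: neighbours_def k j pq)
  define r where "r = c + d"
  have "a + b = r + (p + q)" using pq by (simp add: r_def)
  then have m: "int (colour N k) = (r + (p + q)) mod 3" "int (colour N j) = r mod 3"
    by (simp_all add: int_colour k j r_def)
  have ne: "r mod 3 \<noteq> (r + (p + q)) mod 3"
    using * by (auto; presburger)
  then show "colour N j \<noteq> colour N k" using m by metis
  have two: "(p, q) \<in> {(1, 0), (0, 1), (-1, -1)} \<and> p + q \<in> {1, - 2} \<or>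
      (p, q) \<in> {(-1, 0), (0, -1), (1, 1)} \<and> p + q \<in> {- 1, 2}"
    using * by auto
  have "r mod 3 \<noteq> ((r + e) mod 3 + 2) mod 3" if "e = - 1 \<or> e = 2" for e :: int
    using that by (elim disjE; simp; presburger)
  then have cong2: "(p, q) \<in> {(1, 0), (0, 1), (-1, -1)}"
    if "r mod 3 = ((r + (p + q)) mod 3 + 2) mod 3"
    using two that by blast
  have "r mod 3 \<noteq> ((r + e) mod 3 + 1) mod 3" if "e = 1 \<or> e = - 2" for e :: int
    using that by (elim disjE; simp; presburger)
  then have cong1: "(p, q) \<in> {(-1, 0), (0, -1), (1, 1)}"
    if "r mod 3 = ((r + (p + q)) mod 3 + 1) mod 3"
    using two that by blast
  show "(colour N j = (colour N k + 2) mod 3 \<longrightarrow> coord N k - coord N j \<in> {(1, 0), (0, 1), (-1, -1)}) \<and>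
      (colour N j = (colour N k + 1) mod 3 \<longrightarrow> coord N k - coord N j \<in> {(-1, 0), (0, -1), (1, 1)})"
  proof (intro conjI impI)
    assume "colour N j = (colour N k + 2) mod 3"
    then have "int (colour N j) = (int (colour N k) + 2) mod 3" by (simp only: zmod_int of_nat_add of_nat_numeral of_nat_1)
    then show "coord N k - coord N j \<in> {(1, 0), (0, 1), (-1, -1)}"
      using cong2 unfolding m k j by (simp add: pq)
  next
    assume "colour N j = (colour N k + 1) mod 3"
    then have "int (colour N j) = (int (colour N k) + 1) mod 3" by (simp only: zmod_int of_nat_add of_nat_numeral of_nat_1)
    then show "coord N k - coord N j \<in> {(-1, 0), (0, -1), (1, 1)}"
      using cong1 unfolding m k j by (simp add: pq)
  qed
qed

text \<open>Coordinates are injective, so a neighbour is determined by its offset, and at most three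
  offsets lead to a given colour.\<close>

lemma card_neighbours_colour_le:
  assumes inj: "inj_on (coord N) {1..K}" and p: "p < 3"
  shows "card {j \<in> neighbours K N k. colour N j = p} \<le> 3"
proof -
  let ?W = "{j \<in> neighbours K N k. colour N j = p}"
  have three: "card ?W \<le> 3" if sub: "\<And>j. j \<in> ?W \<Longrightarrow> coord N k - coord N j \<in> D" and D: "finite D" "card D \<le> 3" for D
  proof -
    have "inj_on (coord N) ?W"
      by (rule inj_on_subset[OF inj]) (auto simp: neighbours_def)
    then have "inj_on (\<lambda>j. coord N k - coord N j) ?W"
      by (simp add: inj_on_def)
    then have "card ?W \<le> card D" using sub D(1) by (intro card_inj_on_le) auto
    then show ?thesis using D(2) by simp
  qed
  have "p = colour N k \<or> p = (colour N k + 1) mod 3 \<or> p = (colour N k + 2) mod 3"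
  proof -
    have "x = y \<or> x = (y + 1) mod 3 \<or> x = (y + 2) mod 3" if "x < 3" "y < 3" for x y :: nat
    proof -
      have "x = 0 \<or> x = 1 \<or> x = 2" "y = 0 \<or> y = 1 \<or> y = 2" using that by linarith+
      then show ?thesis by (elim disjE; simp)
    qed
    then show ?thesis using p colour_less[of N k] by blast
  qed
  then consider "p = colour N k" | "p = (colour N k + 1) mod 3" | "p = (colour N k + 2) mod 3" by blast
  then show ?thesis
  proof cases
    case 1
    then have empty: "?W = {}" using colour_neighbour(1) by blast
    show ?thesis unfolding empty by simp
  next
    case 2
    have "coord N k - coord N j \<in> {(-1, 0), (0, -1), (1, 1)}" if "j \<in> ?W" for j
    proof -
      have "j \<in> neighbours K N k" "colour N j = (colour N k + 1) mod 3" using that 2 by auto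
      then show ?thesis using colour_neighbour(2) by blast
    qed
    then show ?thesis by (rule three) (auto simp: card_insert_if)
  next
    case 3
    have "coord N k - coord N j \<in> {(1, 0), (0, 1), (-1, -1)}" if "j \<in> ?W" for j
    proof -
      have "j \<in> neighbours K N k" "colour N j = (colour N k + 2) mod 3" using that 3 by auto
      then show ?thesis using colour_neighbour(2) by blast
    qed
    then show ?thesis by (rule three) (auto simp: card_insert_if)
  qed
qed

text \<open>Colours are below 3, so \<open>p = 3\<close> encodes the last phase: no URLLC Tx sends
  and every eMBB Tx does.\<close>

definition senders :: "nat \<Rightarrow> network \<Rightarrow> activity \<Rightarrow> nat \<Rightarrow> nat set" where
  "senders K N s p = {k \<in> urllc K s. colour N k = p} \<union>
     {k \<in> embb K s. \<forall>j \<in> neighbours K N k \<inter> urllc K s. colour N j \<noteq> p}"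

lemma senders_active: "senders K N s p \<subseteq> active K s"
  by (auto simp: senders_def urllc_def embb_def active_def)

lemma senders_isolated:
  assumes "k \<in> urllc K s" "k \<in> senders K N s p"
  shows "neighbours K N k \<inter> senders K N s p = {}"
proof -
  have k: "colour N k = p" "k \<in> {1..K}"
    using assms by (auto simp: senders_def embb_def urllc_def)
  then show ?thesis
    using assms(1) colour_neighbour(1) neighbours_sym[OF k(2)] by (fastforce simp: senders_def)
qed

text \<open>All colour phases have the same integer length; the slots lost by rounding down fall
  into the last phase.\<close>

definition phase :: "real \<Rightarrow> nat \<Rightarrow> nat \<Rightarrow> nat" where
  "phase a n t = (let L = nat \<lfloor>a * real n\<rfloor> in
     if t \<le> L then 0 else if t \<le> 2 * L then 1 else if t \<le> 3 * L then 2 else 3)"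

lemma phase_le: "phase a n t \<le> 3"
  by (simp add: phase_def Let_def)

definition phase_weight :: "real \<Rightarrow> nat \<Rightarrow> real" where
  "phase_weight a p = (if p < 3 then a else 1 - 3 * a)"

text \<open>Rounding costs each colour phase at most one slot and the last phase none. The three
  colour phases are the origin of the constant 3 in \<open>card_on_times_ge\<close>.\<close>

lemma card_phase_ge:
  assumes a: "0 \<le> a" "a \<le> 1/3" and p: "p \<le> 3"
  shows "phase_weight a p * real n - of_bool (p < 3) \<le> real (card {t \<in> {1..n}. phase a n t = p})"
proof -
  define L where "L = nat \<lfloor>a * real n\<rfloor>"
  have L: "a * real n - 1 \<le> real L" "real L \<le> a * real n"
    using a by (auto simp: L_def) 
  have "a * real n \<le> 1/3 * real n" using a by (intro mult_right_mono) auto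
  then have L3: "3 * L \<le> n" using L(2) by linarith
  have "phase a n t = p \<longleftrightarrow> t \<in> (if p < 3 then {p * L + 1..(p + 1) * L} else {3 * L + 1..n})"
    if "t \<in> {1..n}" for t
  proof -
    consider "p = 0" | "p = 1" | "p = 2" | "p = 3" using p by linarith
    then show ?thesis
      using that L3 by cases (auto simp: phase_def L_def[symmetric])
  qed
  moreover have "(if p < 3 then {p * L + 1..(p + 1) * L} else {3 * L + 1..n}) \<subseteq> {1..n}"
  proof (cases "p < 3")
    case True
    then have "(p + 1) * L \<le> 3 * L" by (intro mult_right_mono) auto
    with L3 have "(p + 1) * L \<le> n" by linarith
    then show ?thesis using True by auto
  qed auto
  ultimately have "{t \<in> {1..n}. phase a n t = p} =
      (if p < 3 then {p * L + 1..(p + 1) * L} else {3 * L + 1..n})"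
    by blast
  then have "card {t \<in> {1..n}. phase a n t = p} = (if p < 3 then L else n - 3 * L)"
    by (simp add: algebra_simps)
  then show ?thesis using L L3 by (auto simp: phase_weight_def of_nat_diff algebra_simps)
qed

definition on_fraction :: "real \<Rightarrow> nat \<Rightarrow> network \<Rightarrow> activity \<Rightarrow> nat \<Rightarrow> real" where
  "on_fraction a K N s k = (\<Sum>p\<le>3. phase_weight a p * of_bool (k \<in> senders K N s p))"

lemma card_on_times_ge:
  assumes a: "0 \<le> a" "a \<le> 1/3"
  shows "on_fraction a K N s k * real n - 3 \<le> real (card {t \<in> {1..n}. k \<in> senders K N s (phase a n t)})"
proof -
  let ?A = "\<lambda>p. {t \<in> {1..n}. phase a n t = p}"
  have "{t \<in> {1..n}. k \<in> senders K N s (phase a n t)} = (\<Union>p\<in>{p\<in>{..3}. k \<in> senders K N s p}. ?A p)"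
    using phase_le[of a n] by auto
  then have "real (card {t \<in> {1..n}. k \<in> senders K N s (phase a n t)}) =
      (\<Sum>p\<in>{p\<in>{..3}. k \<in> senders K N s p}. real (card (?A p)))"
    by (simp only:) (subst card_UN_disjoint, auto)
  also have "\<dots> = (\<Sum>p\<le>3. real (card (?A p)) * of_bool (k \<in> senders K N s p))"
    by (rule sum.mono_neutral_cong_left) auto
  also have "\<dots> \<ge> (\<Sum>p\<le>3. (phase_weight a p * real n - of_bool (p < 3)) * of_bool (k \<in> senders K N s p))"
    using card_phase_ge[OF a] by (intro sum_mono mult_right_mono) auto
  also have "(\<Sum>p\<le>3. (phase_weight a p * real n - of_bool (p < 3)) * of_bool (k \<in> senders K N s p)) =
      on_fraction a K N s k * real n - (\<Sum>p\<le>3. of_bool (p < 3) * of_bool (k \<in> senders K N s p))"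
    unfolding on_fraction_def sum_distrib_right sum_subtractf[symmetric]
    by (intro sum.cong refl) (simp only: algebra_simps)
  finally have "on_fraction a K N s k * real n - (\<Sum>p\<le>3. of_bool (p < 3) * of_bool (k \<in> senders K N s p))
      \<le> real (card {t \<in> {1..n}. k \<in> senders K N s (phase a n t)})" .
  moreover have "(\<Sum>p\<le>3. of_bool (p < 3) * of_bool (k \<in> senders K N s p)) \<le> (\<Sum>p\<le>(3::nat). of_bool (p < 3) :: real)"
    by (intro sum_mono) auto
  moreover have "(\<Sum>p\<le>(3::nat). of_bool (p < 3) :: real) = 3" by (simp add: numeral_3_eq_3)
  ultimately show ?thesis by linarith
qed

text \<open>A URLLC Tx sends in the phase of its own colour and in no other. Its share does not
  depend on the activity, as the common URLLC rate requires.\<close>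

lemma on_fraction_urllc:
  assumes "k \<in> urllc K s"
  shows "on_fraction a K N s k = a"
proof -
  have "k \<in> senders K N s p \<longleftrightarrow> p = colour N k" for p
    using assms by (auto simp: senders_def embb_def)
  then show ?thesis using colour_less[of N k]
    by (simp add: on_fraction_def of_bool_def phase_weight_def if_distrib[of "(*) _"] cong: if_cong)
qed

section \<open>Expected time share of the eMBB cells\<close>

lemma expectation_cell_activity:
  fixes f :: "bool \<times> bool \<Rightarrow> real"
  assumes "\<rho> \<in> {0..1}" "\<rho>\<^sub>f \<in> {0..1}"
  shows "measure_pmf.expectation (cell_activity_pmf \<rho> \<rho>\<^sub>f) f =
    \<rho> * (\<rho>\<^sub>f * f (True, True) + (1 - \<rho>\<^sub>f) * f (True, False)) + (1 - \<rho>) * f (False, False)"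
  unfolding cell_activity_pmf_def using assms
  by (subst pmf_expectation_bind[where A = UNIV]) (auto simp: UNIV_bool)

text \<open>The event is an intersection of conditions on single cells, so its indicator is a
  product and independence applies.\<close>

lemma expectation_embb_quiet:
  assumes \<rho>: "\<rho> \<in> {0..1}" "\<rho>\<^sub>f \<in> {0..1}" and k: "k \<in> {1..K}" and W: "W \<subseteq> {1..K}" "k \<notin> W"
  shows "measure_pmf.expectation (activity_pmf \<rho> \<rho>\<^sub>f K) (\<lambda>s. of_bool (k \<in> embb K s \<and> W \<inter> urllc K s = {}))
    = \<rho> * (1 - \<rho>\<^sub>f) * (1 - \<rho> * \<rho>\<^sub>f) ^ card W"
proof -
  define f :: "nat \<Rightarrow> bool \<times> bool \<Rightarrow> real" where
    "f x ab = (if x = k then of_bool (fst ab \<and> \<not> snd ab) else if x \<in> W then of_bool (\<not> (fst ab \<and> snd ab)) else 1)" for x ab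
  have "of_bool (k \<in> embb K s \<and> W \<inter> urllc K s = {}) = (\<Prod>x\<in>{1..K}. f x (s x))" for s
  proof (cases "k \<in> embb K s \<and> W \<inter> urllc K s = {}")
    case True
    then have "f x (s x) = 1" if "x \<in> {1..K}" for x
      using that by (auto simp: f_def embb_def urllc_def active_def)
    then show ?thesis using True by simp
  next
    case False
    then have "\<exists>x\<in>{1..K}. f x (s x) = 0"
      using k W by (fastforce simp: f_def embb_def urllc_def active_def)
    then show ?thesis using False by (subst prod_zero) auto
  qed
  then have "measure_pmf.expectation (activity_pmf \<rho> \<rho>\<^sub>f K) (\<lambda>s. of_bool (k \<in> embb K s \<and> W \<inter> urllc K s = {}))
      = (\<Prod>x\<in>{1..K}. measure_pmf.expectation (cell_activity_pmf \<rho> \<rho>\<^sub>f) (f x))"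
    unfolding activity_pmf_def
    by (simp only:) (rule expectation_prod_Pi_pmf; auto simp: f_def intro!: integrable_measure_pmf_finite)
  also have "\<dots> = (\<Prod>x\<in>{1..K}. if x = k then \<rho> * (1 - \<rho>\<^sub>f) else if x \<in> W then 1 - \<rho> * \<rho>\<^sub>f else 1)"
    using W(2) by (intro prod.cong refl) (auto simp: expectation_cell_activity[OF \<rho>] f_def algebra_simps)
  also have "\<dots> = \<rho> * (1 - \<rho>\<^sub>f) * (\<Prod>x\<in>{1..K} - {k}. if x \<in> W then 1 - \<rho> * \<rho>\<^sub>f else 1)"
    using k by (subst prod.remove[of _ k]) (auto intro!: prod.cong)
  also have "(\<Prod>x\<in>{1..K} - {k}. if x \<in> W then 1 - \<rho> * \<rho>\<^sub>f else 1) = (\<Prod>x\<in>W. 1 - \<rho> * \<rho>\<^sub>f)"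
    using W by (intro prod.mono_neutral_cong_right) auto
  finally show ?thesis by simp
qed

text \<open>In the phase of its own colour and in the last phase an eMBB cell always sends. In each
  of the other two phases it is heard with probability at least
  \<open>(1 - \<rho> * \<rho>\<^sub>f) ^ 3\<close>; cells with fewer than three neighbours of that
  colour do better, hence an inequality.\<close>

lemma expectation_on_fraction_ge:
  assumes inj: "inj_on (coord N) {1..K}" and \<rho>: "\<rho> \<in> {0..1}" "\<rho>\<^sub>f \<in> {0..1}"
    and a: "0 \<le> a" "a \<le> 1/3" and k: "k \<in> {1..K}"
  shows "\<rho> * (1 - \<rho>\<^sub>f) * (1 - 2 * a * (1 - (1 - \<rho> * \<rho>\<^sub>f) ^ 3)) \<le>
    measure_pmf.expectation (activity_pmf \<rho> \<rho>\<^sub>f K) (\<lambda>s. of_bool (k \<in> embb K s) * on_fraction a K N s k)"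
proof -
  let ?E = "measure_pmf.expectation (activity_pmf \<rho> \<rho>\<^sub>f K)"
  define W where "W p = {j \<in> neighbours K N k. colour N j = p}" for p
  define b where "b = 1 - \<rho> * \<rho>\<^sub>f"
  have b: "0 \<le> b" "b \<le> 1" using \<rho> by (auto simp: b_def mult_le_one)
  have c: "0 \<le> \<rho> * (1 - \<rho>\<^sub>f)" using \<rho> by auto
  have W: "W p \<subseteq> {1..K}" "k \<notin> W p" for p
    using colour_neighbour(1)[of k K N k] by (auto simp: W_def) (auto simp: neighbours_def)
  have WE: "W p = {}" if "p = colour N k \<or> p = 3" for p
  proof -
    have "colour N j \<noteq> p" if "j \<in> neighbours K N k" for j
      using \<open>p = colour N k \<or> p = 3\<close> colour_neighbour(1)[OF that] colour_less[of N j] by auto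
    then show ?thesis by (auto simp: W_def)
  qed
  have eq: "of_bool (k \<in> embb K s) * on_fraction a K N s k =
      (\<Sum>p\<le>3. phase_weight a p * of_bool (k \<in> embb K s \<and> W p \<inter> urllc K s = {}))" for s
  proof -
    have "of_bool (k \<in> embb K s) * of_bool (k \<in> senders K N s p) =
        (of_bool (k \<in> embb K s \<and> W p \<inter> urllc K s = {}) :: real)" for p
      by (auto simp: senders_def W_def embb_def)
    then show ?thesis unfolding on_fraction_def sum_distrib_left
      by (simp add: mult.left_commute)
  qed
  have "?E (\<lambda>s. of_bool (k \<in> embb K s) * on_fraction a K N s k) =
      (\<Sum>p\<le>3. phase_weight a p * ?E (\<lambda>s. of_bool (k \<in> embb K s \<and> W p \<inter> urllc K s = {})))"
    unfolding eq
    by (subst Bochner_Integration.integral_sum)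
      (auto intro: integrable_measure_pmf_finite finite_set_activity_pmf)
  also have "\<dots> = (\<Sum>p\<le>3. phase_weight a p * (\<rho> * (1 - \<rho>\<^sub>f) * b ^ card (W p)))"
    unfolding b_def using expectation_embb_quiet[OF \<rho> k W] by simp
  also have "\<dots> \<ge> (\<Sum>p\<le>3. phase_weight a p * (\<rho> * (1 - \<rho>\<^sub>f) * (if p = colour N k \<or> p = 3 then 1 else b ^ 3)))"
  proof (intro sum_mono mult_left_mono)
    fix p :: nat assume p: "p \<in> {..3}"
    show "0 \<le> phase_weight a p" using a by (auto simp: phase_weight_def)
    show "(if p = colour N k \<or> p = 3 then 1 else b ^ 3) \<le> b ^ card (W p)"
    proof (cases "p = colour N k \<or> p = 3")
      case False
      then have "card (W p) \<le> 3"
        unfolding W_def using p by (intro card_neighbours_colour_le inj) auto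
      then show ?thesis using False b by (auto intro: power_decreasing)
    qed (use WE in auto)
  qed (use c in auto)
  also have "(\<Sum>p\<le>3. phase_weight a p * (\<rho> * (1 - \<rho>\<^sub>f) * (if p = colour N k \<or> p = 3 then 1 else b ^ 3))) =
      \<rho> * (1 - \<rho>\<^sub>f) * (1 - 2 * a * (1 - b ^ 3))"
  proof -
    have "colour N k = 0 \<or> colour N k = 1 \<or> colour N k = 2" using colour_less[of N k] by linarith
    moreover have "(\<Sum>p\<le>3. g p) = g 0 + g 1 + g 2 + g 3" for g :: "nat \<Rightarrow> real"
      by (simp add: eval_nat_numeral)
    ultimately show ?thesis
      by (elim disjE; simp add: phase_weight_def; simp add: algebra_simps)
  qed
  finally show ?thesis by (simp add: b_def)
qed

section \<open>From rates to multiplexing gains\<close>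

lemma Limsup_prelog:
  assumes "0 \<le> a"
  shows "Limsup at_top (\<lambda>P. ereal (max 0 (a * (1/2 * log 2 P) - \<beta>) / (1/2 * log 2 P))) = ereal a"
proof (rule lim_imp_Limsup)
  let ?l = "\<lambda>P::real. 1/2 * log 2 P"
  have "filterlim (\<lambda>P::real. 1 / (2 * ln 2) * ln P) at_top at_top"
    by (rule filterlim_tendsto_pos_mult_at_top[OF tendsto_const _ ln_at_top]) simp
  then have l: "filterlim ?l at_top at_top" by (simp add: log_def)
  then have "((\<lambda>P. \<beta> / ?l P) \<longlongrightarrow> 0) at_top"
    by (intro tendsto_divide_0[OF tendsto_const] filterlim_at_top_imp_at_infinity)
  then have "((\<lambda>P. max 0 (a - \<beta> / ?l P)) \<longlongrightarrow> max 0 (a - 0)) at_top"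
    by (intro tendsto_max tendsto_diff tendsto_const)
  moreover have "\<forall>\<^sub>F P in at_top. max 0 (a - \<beta> / ?l P) = max 0 (a * ?l P - \<beta>) / ?l P"
  proof -
    have "\<forall>\<^sub>F P in at_top. 0 < ?l P" using l unfolding filterlim_at_top_dense by (rule spec)
    then show ?thesis
      by eventually_elim (simp add: max_def field_simps)
  qed
  ultimately have "((\<lambda>P. max 0 (a * ?l P - \<beta>) / ?l P) \<longlongrightarrow> max 0 (a - 0)) at_top"
    by (rule Lim_transform_eventually)
  then show "((\<lambda>P. ereal (max 0 (a * ?l P - \<beta>) / ?l P)) \<longlongrightarrow> ereal a) at_top"
    using assms by simp
qed simp

lemma colour_phases_achievable:
  assumes net: "hexagonal_network K N" "generic_gains K N" and K: "1 \<le> K"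
    and \<rho>: "\<rho> \<in> {0..1}" "\<rho>\<^sub>f \<in> {0..1}" and a: "0 \<le> a" "a \<le> 1/3" and b: "0 \<le> b"
    and ab: "b \<le> \<rho> * (1 - \<rho>\<^sub>f) * (1 - 2 * a * (1 - (1 - \<rho> * \<rho>\<^sub>f) ^ 3))"
  shows "\<exists>\<beta>. \<forall>P>0. achievable_rates K N \<rho> \<rho>\<^sub>f P
    (max 0 (a * (1/2 * log 2 P) - \<beta>)) (max 0 (b * (1/2 * log 2 P) - \<beta>))"
proof -
  define w where "w = on_fraction a K N"
  define T where "T n s t = senders K N s (phase a n t)" for n s t
  have w0: "0 \<le> w s k" for s k
    using a by (auto simp: w_def on_fraction_def phase_weight_def intro!: sum_nonneg mult_nonneg_nonneg)
  have "\<exists>\<beta>\<ge>0. \<forall>P>0. \<forall>R\<^sub>U R\<^sub>e.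
    (\<forall>s. \<forall>k\<in>active K s. tx_rate K R\<^sub>U R\<^sub>e s k = max 0 (w s k * (1/2 * log 2 P) - \<beta>)) \<longrightarrow>
    (\<exists>c. (\<forall>n\<ge>1. valid_scheme K N \<rho> \<rho>\<^sub>f P R\<^sub>U R\<^sub>e n (c n)) \<and>
      (\<lambda>n. error_prob K N \<rho> \<rho>\<^sub>f R\<^sub>U R\<^sub>e n (c n)) \<longlonglongrightarrow> 0)"
  proof (rule scheduled_rates_achievable[where T = T])
    show "w s k * real n - 3 \<le> real (card {t \<in> {1..n}. k \<in> T n s t})" for n s k
      unfolding w_def T_def by (rule card_on_times_ge[OF a])
    show "neighbours K N k \<inter> T n s t = {}" if "k \<in> urllc K s" "k \<in> T n s t" for n k s t
      using that unfolding T_def by (rule senders_isolated)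
  qed (use net(2) w0 in \<open>auto simp: T_def intro: senders_active[THEN subsetD]\<close>)
  then obtain \<beta> where \<beta>: "0 \<le> \<beta>" and ach: "\<forall>P>0. \<forall>R\<^sub>U R\<^sub>e.
    (\<forall>s. \<forall>k\<in>active K s. tx_rate K R\<^sub>U R\<^sub>e s k = max 0 (w s k * (1/2 * log 2 P) - \<beta>)) \<longrightarrow>
    (\<exists>c. (\<forall>n\<ge>1. valid_scheme K N \<rho> \<rho>\<^sub>f P R\<^sub>U R\<^sub>e n (c n)) \<and>
      (\<lambda>n. error_prob K N \<rho> \<rho>\<^sub>f R\<^sub>U R\<^sub>e n (c n)) \<longlonglongrightarrow> 0)"
    by blast
  let ?E = "measure_pmf.expectation (activity_pmf \<rho> \<rho>\<^sub>f K)"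
  have int: "integrable (measure_pmf (activity_pmf \<rho> \<rho>\<^sub>f K)) f" for f :: "activity \<Rightarrow> real"
    by (rule integrable_measure_pmf_finite[OF finite_set_activity_pmf])
  have "achievable_rates K N \<rho> \<rho>\<^sub>f P (max 0 (a * (1/2 * log 2 P) - \<beta>)) (max 0 (b * (1/2 * log 2 P) - \<beta>))"
    if P: "0 < P" for P
  proof -
    define l where "l = 1/2 * log 2 P"
    define R where "R s k = max 0 (w s k * l - \<beta>)" for s k
    have "tx_rate K (max 0 (a * l - \<beta>)) R s k = max 0 (w s k * l - \<beta>)" if "k \<in> active K s" for s k
      by (simp add: tx_rate_def R_def w_def on_fraction_urllc)
    then obtain c where c: "\<forall>n\<ge>1. valid_scheme K N \<rho> \<rho>\<^sub>f P (max 0 (a * l - \<beta>)) R n (c n)"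
      "(\<lambda>n. error_prob K N \<rho> \<rho>\<^sub>f (max 0 (a * l - \<beta>)) R n (c n)) \<longlonglongrightarrow> 0"
      using ach P unfolding l_def by blast
    have "max 0 (b * l - \<beta>) \<le> ?E (\<lambda>s. (1 / real K) * (\<Sum>k\<in>embb K s. R s k))"
    proof (rule max.boundedI)
      show "0 \<le> ?E (\<lambda>s. (1 / real K) * (\<Sum>k\<in>embb K s. R s k))"
        by (intro Bochner_Integration.integral_nonneg mult_nonneg_nonneg sum_nonneg) (auto simp: R_def)
      show "b * l - \<beta> \<le> ?E (\<lambda>s. (1 / real K) * (\<Sum>k\<in>embb K s. R s k))"
      \<comment> \<open>For \<open>P\<close> below 1 the factor \<open>l\<close> is negative and the
        bound on the time share cannot be multiplied by it, but the claimed rate is then at most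
        zero.\<close>
      proof (cases "0 \<le> l")
        case False
        then have "b * l \<le> 0" using b by (simp add: mult_le_0_iff)
        then show ?thesis
          using \<beta> \<open>0 \<le> ?E (\<lambda>s. (1 / real K) * (\<Sum>k\<in>embb K s. R s k))\<close> by linarith
      next
        case True
        have embb: "embb K s \<subseteq> {1..K}" for s by (auto simp: embb_def active_def)
        have "b * l - \<beta> = (1 / real K) * (\<Sum>k\<in>{1..K}. b * l - \<beta>)" using K by simp
        also have "\<dots> \<le> (1 / real K) * (\<Sum>k\<in>{1..K}. ?E (\<lambda>s. of_bool (k \<in> embb K s) * w s k) * l - \<beta>)"
        proof (intro mult_left_mono sum_mono diff_mono mult_right_mono)
          fix k assume "k \<in> {1..K}"
          then show "b \<le> ?E (\<lambda>s. of_bool (k \<in> embb K s) * w s k)"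
            unfolding w_def using net(1)
            by (intro order_trans[OF ab expectation_on_fraction_ge[OF _ \<rho> a]])
              (auto simp: hexagonal_network_def)
        qed (use True in auto)
        also have "\<dots> = ?E (\<lambda>s. (1 / real K) * (\<Sum>k\<in>{1..K}. of_bool (k \<in> embb K s) * w s k * l - \<beta>))"
          using int by (simp add: measure_pmf.prob_space)
        \<comment> \<open>Cells outside \<open>embb K s\<close> contribute \<open>- \<beta>\<close>
          on the left and nothing on the right; for the others the truncation only increases the
          rate.\<close>
        also have "\<dots> \<le> ?E (\<lambda>s. (1 / real K) * (\<Sum>k\<in>embb K s. R s k))"
        proof (intro Bochner_Integration.integral_mono int mult_left_mono)
          fix s
          have "(\<Sum>k\<in>{1..K}. of_bool (k \<in> embb K s) * w s k * l - \<beta>)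
              \<le> (\<Sum>k\<in>{1..K}. if k \<in> embb K s then R s k else 0)"
            using \<beta> by (intro sum_mono) (auto simp: R_def)
          also have "\<dots> = (\<Sum>k\<in>embb K s. R s k)"
            using embb[of s] by (subst sum.inter_restrict[symmetric]) (auto simp: Int_absorb1)
          finally show "(\<Sum>k\<in>{1..K}. of_bool (k \<in> embb K s) * w s k * l - \<beta>) \<le> (\<Sum>k\<in>embb K s. R s k)" .
        qed auto
        finally show ?thesis .
      qed
    qed
    moreover have "\<forall>s. \<forall>k\<in>embb K s. 0 \<le> R s k" by (simp add: R_def)
    ultimately show ?thesis
      unfolding achievable_rates_def l_def[symmetric] using c
      by (intro conjI exI[of _ R] exI[of _ c]) auto
  qed
  then show ?thesis by blast
qed

theorem theorem10:
  fixes N :: "nat \<Rightarrow> network" and \<rho> \<rho>\<^sub>f :: real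
  assumes "\<And>K. hexagonal_network K (N K)"
    and "\<And>K. generic_gains K (N K)"
    and "0 < \<rho>" and "\<rho> < 1"
    and "0 < \<rho>\<^sub>f" and "\<rho>\<^sub>f \<le> 1"
  shows "{(S\<^sub>U, S\<^sub>e). 0 \<le> S\<^sub>U \<and> 0 \<le> S\<^sub>e \<and> S\<^sub>U \<le> \<rho> * \<rho>\<^sub>f / 3 \<and>
            S\<^sub>e + (2 * (1 - \<rho>\<^sub>f) * (1 - (1 - \<rho> * \<rho>\<^sub>f) ^ 3) / \<rho>\<^sub>f) * S\<^sub>U \<le> \<rho> * (1 - \<rho>\<^sub>f)}
         \<subseteq> MG_region N \<rho> \<rho>\<^sub>f"
proof clarify
  fix S\<^sub>U S\<^sub>e :: real
  assume S: "0 \<le> S\<^sub>U" "0 \<le> S\<^sub>e" "S\<^sub>U \<le> \<rho> * \<rho>\<^sub>f / 3"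
    "S\<^sub>e + (2 * (1 - \<rho>\<^sub>f) * (1 - (1 - \<rho> * \<rho>\<^sub>f) ^ 3) / \<rho>\<^sub>f) * S\<^sub>U \<le> \<rho> * (1 - \<rho>\<^sub>f)"
  \<comment> \<open>Inverts the relation between the URLLC gain and the phase length, since a URLLC
    Tx has rate about \<open>a * (1/2 * log 2 P)\<close>.\<close>
  define a where "a = S\<^sub>U / (\<rho> * \<rho>\<^sub>f)"
  have pos: "0 < \<rho> * \<rho>\<^sub>f" using assms by simp
  have a: "0 \<le> a" "a \<le> 1/3" "S\<^sub>U = \<rho> * \<rho>\<^sub>f * a"
    using S pos assms by (auto simp: a_def field_simps)
  have "S\<^sub>e \<le> \<rho> * (1 - \<rho>\<^sub>f) * (1 - 2 * a * (1 - (1 - \<rho> * \<rho>\<^sub>f) ^ 3))"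
  proof -
    have "(2 * (1 - \<rho>\<^sub>f) * (1 - (1 - \<rho> * \<rho>\<^sub>f) ^ 3) / \<rho>\<^sub>f) * S\<^sub>U
        = \<rho> * (1 - \<rho>\<^sub>f) * (2 * a * (1 - (1 - \<rho> * \<rho>\<^sub>f) ^ 3))"
      unfolding a(3) using assms by simp
    then show ?thesis using S(4) by (simp add: right_diff_distrib)
  qed
  then have "\<exists>\<beta>. \<forall>P>0. achievable_rates K (N K) \<rho> \<rho>\<^sub>f P
    (max 0 (a * (1/2 * log 2 P) - \<beta>)) (max 0 (S\<^sub>e * (1/2 * log 2 P) - \<beta>))" if "1 \<le> K" for K
    using assms a S that by (intro colour_phases_achievable) auto
  \<comment> \<open>The gap may grow with \<open>K\<close>: the limit in \<open>P\<close> is taken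
    first for each fixed \<open>K\<close> and removes it.\<close>
  then obtain \<beta> where \<beta>: "\<And>K P. 1 \<le> K \<Longrightarrow> 0 < P \<Longrightarrow> achievable_rates K (N K) \<rho> \<rho>\<^sub>f P
    (max 0 (a * (1/2 * log 2 P) - \<beta> K)) (max 0 (S\<^sub>e * (1/2 * log 2 P) - \<beta> K))"
    by metis
  have "achievable_MG N \<rho> \<rho>\<^sub>f S\<^sub>U S\<^sub>e"
    unfolding achievable_MG_def
  proof (intro exI conjI allI impI)
    show "achievable_rates K (N K) \<rho> \<rho>\<^sub>f P
      (max 0 (a * (1/2 * log 2 P) - \<beta> K)) (max 0 (S\<^sub>e * (1/2 * log 2 P) - \<beta> K))"
      if "1 \<le> K" "0 < P" for K P
      using \<beta> that by blast
    show "ereal S\<^sub>U = ereal (\<rho> * \<rho>\<^sub>f) * limsup (\<lambda>K. Limsup at_top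
        (\<lambda>P. ereal (max 0 (a * (1/2 * log 2 P) - \<beta> K) / (1/2 * log 2 P))))"
      unfolding Limsup_prelog[OF a(1)] by (simp add: Limsup_const a(3))
    show "ereal S\<^sub>e = limsup (\<lambda>K. Limsup at_top
        (\<lambda>P. ereal (max 0 (S\<^sub>e * (1/2 * log 2 P) - \<beta> K) / (1/2 * log 2 P))))"
      unfolding Limsup_prelog[OF S(2)] by (simp add: Limsup_const)
  qed
  then show "(S\<^sub>U, S\<^sub>e) \<in> MG_region N \<rho> \<rho>\<^sub>f"
    unfolding MG_region_def by (intro closure_subset[THEN subsetD]) simp
qed

end
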